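(* Let $E/\mathbb Q(t)$ be $y^2=x^3-t^2x+t^2$. Let $T$ be the set of integers $t_0>2$ which are not of any of the following four forms for any $n\in\mathbb Z$: (1) $64(uv^3+3v^4)$ with $u=\frac{(1+\sqrt2)^{2n}+(1-\sqrt2)^{2n}}{2}$, $v=\frac{(1+\sqrt2)^{2n}-(1-\sqrt2)^{2n}}{4\sqrt2}$; (2) $4(uv^3+3v^4)$ with $u=(1+\sqrt2)^{2n+1}+(1-\sqrt2)^{2n+1}$, $v=\frac{(1+\sqrt2)^{2n+1}-(1-\sqrt2)^{2n+1}}{2\sqrt2}$; (3) $uv^3+3v^4$ with $u=\sqrt2\big((1+\sqrt2)^{2n+1}-(1-\sqrt2)^{2n+1}\big)$, $v=\frac{(1+\sqrt2)^{2n+1}+(1-\sqrt2)^{2n+1}}{2}$; (4) $uv^3+3v^4$ with $u=\sqrt2\big((1+\sqrt2)^{2n}-(1-\sqrt2)^{2n}\big)$, $v=\frac{(1+\sqrt2)^{2n}+(1-\sqrt2)^{2n}}{2}$. Then $T\subseteq\mathbb N$ has natural density $1$, and for each $t_0\in T$ the specialization map $\sigma_{t_0}:E(\mathbb Q(t))\to E_{t_0}(\mathbb Q)$ is injective.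
   Context: $E_{t_0}$ is the elliptic curve $y^2=x^3-t_0^2x+t_0^2$ over $\mathbb Q$ and $\sigma_{t_0}$ is the specialization homomorphism $(x(t),y(t))\mapsto(x(t_0),y(t_0))$. The natural density of $T\subseteq\mathbb N$ is $\lim_{n\to\infty}\#\{k\in T:k\le n\}/n$. *)

theory Defs
  imports "HOL-Analysis.Analysis" "HOL-Computational_Algebra.Polynomial"
    "HOL-Computational_Algebra.Fraction_Field"
begin

type_synonym ratfun = "rat poly fract"

definition tvar :: ratfun where
  "tvar = Fract [:0, 1:] 1"

text \<open>Points of E(Q(t)) for E: y^2 = x^3 - t^2 x + t^2; None is the point at infinity.\<close>
definition E_points :: "(ratfun \<times> ratfun) option set" where
  "E_points = {None} \<union>
     {Some (x, y) | x y. y ^ 2 = x ^ 3 - tvar ^ 2 * x + tvar ^ 2}"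

definition E_fiber_points :: "rat \<Rightarrow> (rat \<times> rat) option set" where
  "E_fiber_points a = {None} \<union>
     {Some (x, y) | x y. y ^ 2 = x ^ 3 - a ^ 2 * x + a ^ 2}"

definition regular_at :: "rat \<Rightarrow> ratfun \<Rightarrow> bool" where
  "regular_at a f \<longleftrightarrow> (\<exists>p q. poly q a \<noteq> 0 \<and> f = Fract p q)"

definition eval_at :: "rat \<Rightarrow> ratfun \<Rightarrow> rat" where
  "eval_at a f = (SOME c. \<exists>p q. poly q a \<noteq> 0 \<and> f = Fract p q \<and> c = poly p a / poly q a)"

fun specialize :: "rat \<Rightarrow> (ratfun \<times> ratfun) option \<Rightarrow> (rat \<times> rat) option" where
  "specialize a None = None"
| "specialize a (Some (x, y)) =
     (if regular_at a x \<and> regular_at a y then Some (eval_at a x, eval_at a y) else None)"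

definition natural_density :: "nat set \<Rightarrow> real \<Rightarrow> bool" where
  "natural_density S d \<longleftrightarrow>
     ((\<lambda>n. real (card {k \<in> S. k \<le> n}) / real n) \<longlonglongrightarrow> d)"

definition form1 :: "int \<Rightarrow> real" where
  "form1 n = (let a = 1 + sqrt 2; b = 1 - sqrt 2;
      u = (a powi (2*n) + b powi (2*n)) / 2;
      v = (a powi (2*n) - b powi (2*n)) / (4 * sqrt 2)
    in 64 * (u * v ^ 3 + 3 * v ^ 4))"

definition form2 :: "int \<Rightarrow> real" where
  "form2 n = (let a = 1 + sqrt 2; b = 1 - sqrt 2;
      u = a powi (2*n+1) + b powi (2*n+1);
      v = (a powi (2*n+1) - b powi (2*n+1)) / (2 * sqrt 2)
    in 4 * (u * v ^ 3 + 3 * v ^ 4))"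

definition form3 :: "int \<Rightarrow> real" where
  "form3 n = (let a = 1 + sqrt 2; b = 1 - sqrt 2;
      u = sqrt 2 * (a powi (2*n+1) - b powi (2*n+1));
      v = (a powi (2*n+1) + b powi (2*n+1)) / 2
    in u * v ^ 3 + 3 * v ^ 4)"

definition form4 :: "int \<Rightarrow> real" where
  "form4 n = (let a = 1 + sqrt 2; b = 1 - sqrt 2;
      u = sqrt 2 * (a powi (2*n) - b powi (2*n));
      v = (a powi (2*n) + b powi (2*n)) / 2
    in u * v ^ 3 + 3 * v ^ 4)"

definition T_set :: "nat set" where
  "T_set = {t0. t0 > 2 \<and> \<not> (\<exists>n::int. real t0 = form1 n \<or> real t0 = form2 n
                                   \<or> real t0 = form3 n \<or> real t0 = form4 n)}"

end

theory Submission
  imports Defs "HOL-Computational_Algebra.Computational_Algebra"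
    "HOL-Computational_Algebra.Field_as_Ring" "HOL-Real_Asymp.Real_Asymp"
begin

text \<open>
  The proof is a 2-descent that never needs the group law as a whole. Put $f = X^3 - t^2 X + t^2$.
  The cubic field $\mathbb Q(t)[X]/(f)$ is the rational function field $\mathbb Q(s)$ with
  $t = s^3/(s^2-1)$ and root $\theta = s^2/(s^2-1) = ts - s^2$, and $s^3 = ts^2 - t$. For a point with
  $x = p/d^2$ in lowest terms, unique factorisation in $\mathbb Q[s]$ shows that
  $p - \theta d^2 = \varepsilon h^2$ with $h \in \mathbb Q[t][s]$ and
  $\varepsilon \in \{1, 1-s, 1+s, 1-s^2\}$; the last three are the classes of the points with
  $x = -t, t, 0$.

  Suppose that a point specialises to infinity at $t_0$, i.e. $d(t_0) = 0$. If $\varepsilon \neq 1$,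
  setting $t = t_0$ shows that one of $-t_0, t_0, 0$ is the $x$-coordinate of the double of a rational
  point of the fibre, which for $t_0 > 2$ leads to a Pell equation and to the four exceptional forms. If
  $\varepsilon = 1$, the point is the double of a point which again specialises to infinity, as the
  fibre has no rational 2-torsion, and whose denominator has smaller degree. By infinite descent no
  point specialises to infinity. Finally, if two distinct points had the same specialisation, their
  difference would specialise to infinity.

  The exceptional forms are $4P^3(2H+3P)$ and $H^3(4P+3H)$ with $H + P\sqrt 2 = (1+\sqrt 2)^k$; they
  grow at least like $k^2$, so there are $O(\sqrt n)$ of them up to $n$.
\<close>

section \<open>Halving points\<close>

text \<open>The coordinates of $(a + bs + cs^2)^2$ in the basis $1, s, s^2$, where $s^3 = ts^2 - t$.\<close>

definition sq0 :: "'a::comm_ring_1 \<Rightarrow> 'a \<Rightarrow> 'a \<Rightarrow> 'a \<Rightarrow> 'a" where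
  "sq0 t a b c = a^2 - 2 * t * b * c - t^2 * c^2"

definition sq1 :: "'a::comm_ring_1 \<Rightarrow> 'a \<Rightarrow> 'a \<Rightarrow> 'a \<Rightarrow> 'a" where
  "sq1 t a b c = 2 * a * b - t * c^2"

definition sq2 :: "'a::comm_ring_1 \<Rightarrow> 'a \<Rightarrow> 'a \<Rightarrow> 'a \<Rightarrow> 'a" where
  "sq2 t a b c = b^2 + 2 * a * c + 2 * t * b * c + t^2 * c^2"

lemmas sq_defs = sq0_def sq1_def sq2_def

text \<open>
  The three equations say $Z^3 - t^2 Z + t^2 = (a + bZ)^2 + (Z - x)(Z - X)^2$: the line $Y = a + bZ$ is
  tangent at the point with abscissa $X$, whose double has abscissa $x$.
\<close>

definition doubled_x :: "'a::field \<Rightarrow> 'a \<Rightarrow> bool" where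
  "doubled_x t x \<longleftrightarrow>
    (\<exists>X a b. b^2 = x + 2 * X \<and> 2 * a * b + X^2 + 2 * x * X = -(t^2) \<and> a^2 - x * X^2 = t^2)"

text \<open>
  The hypothesis is $x - \theta = h^2$ with $h = u_0 + u_1 s + u_2 s^2$. Multiplying $h$ by a suitable
  linear polynomial in $\theta$, here $k\theta - t u_2$, gives a linear polynomial $c_0 + c_1 \theta$.
  Comparing coefficients of $(x - \theta)(k\theta - t u_2)^2 = (c_0 + c_1\theta)^2$ gives the tangent line.
  The \<open>z\<close>'s are the coordinates of $(h^2 - (x - \theta))(k\theta - tu_2)^2$.
\<close>

lemma doubled_x_of_square:
  fixes t x u0 u1 u2 :: "'a::field"
  assumes t: "t \<noteq> 0"
    and sq: "sq0 t u0 u1 u2 = x" "sq1 t u0 u1 u2 = - t" "sq2 t u0 u1 u2 = 1"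
  shows "doubled_x t x"
proof -
  note h0 = sq(1)[unfolded sq_defs] and h1 = sq(2)[unfolded sq_defs] and h2 = sq(3)[unfolded sq_defs]
  define k c0 c1 where "k = u1 + t * u2" and "c0 = t * k * u1 - t * u2 * u0" and "c1 = k * u0 + t * u2^2"
  \<comment> \<open>If \<open>k = 0\<close>, the third coordinate reads
    \<open>2 * u0 * u2 = 1\<close>, and the second then forces \<open>u2 = 0\<close>.\<close>
  have k: "k \<noteq> 0"
  proof
    assume "k = 0"
    then have "u1 = - t * u2" by (simp add: k_def eq_neg_iff_add_eq_0)
    with h1 h2 t show False by algebra
  qed
  define e0 e1 e2 where "e0 = u0^2 - 2 * t * u1 * u2 - t^2 * u2^2 - x"
    and "e1 = 2 * u0 * u1 - t * u2^2 + t"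
    and "e2 = u1^2 + 2 * u0 * u2 + 2 * t * u1 * u2 + t^2 * u2^2 - 1"
  have e: "e0 = 0" "e1 = 0" "e2 = 0" using h0 h1 h2 by (auto simp: e0_def e1_def e2_def)
  define m0 m1 m2 where "m0 = t^2 * u2^2 + t^2 * k^2" and "m1 = - 2 * t^2 * u2 * k - t * k^2"
    and "m2 = 2 * t * u2 * k"
  define z0 z1 z2 where "z0 = e0 * m0 - t * (e1 * m2 + e2 * m1) - t^2 * e2 * m2"
    and "z1 = e0 * m1 + e1 * m0 - t * e2 * m2"
    and "z2 = e0 * m2 + e1 * m1 + e2 * m0 + t * (e1 * m2 + e2 * m1) + t^2 * e2 * m2"
  note defs = z0_def z1_def z2_def m0_def m1_def m2_def e0_def e1_def e2_def c0_def c1_def k_def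
  have z: "z0 = 0" "z1 = 0" "z2 = 0" by (simp_all add: z0_def z1_def z2_def e)
  have "t * (c1^2 - (x * k^2 + 2 * t * u2 * k)) = - (z1 + t * z2)" unfolding defs by algebra
  then have e1: "c1^2 = x * k^2 + 2 * t * u2 * k" using t z by simp
  have "2 * c0 * c1 + t^2 * u2^2 + 2 * x * t * u2 * k + t^2 * k^2 = - z2" unfolding defs by algebra
  then have e2: "2 * c0 * c1 + t^2 * u2^2 + 2 * x * t * u2 * k = -(t^2 * k^2)" using z by (simp add: eq_neg_iff_add_eq_0)
  have "c0^2 - x * t^2 * u2^2 - t^2 * k^2 = z0 + t * (z1 + t * z2)" unfolding defs by algebra
  then have e3: "c0^2 - x * t^2 * u2^2 = t^2 * k^2" using z by simp
  show ?thesis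
    unfolding doubled_x_def
    by (rule exI[of _ "t * u2/k"], rule exI[of _ "c0/k"], rule exI[of _ "c1/k"])
       (use e1 e2 e3 k in \<open>simp add: field_simps power2_eq_square\<close>)
qed

text \<open>
  Here $k^2 = \varepsilon h^2$ with $\varepsilon = 1 + s, 1 - s, 1 - s^2$ respectively. Since
  $(x - \theta)\varepsilon = s^2$ in the three cases, $x - \theta = (sh/k)^2$.
\<close>

lemma doubled_x_of_square_class:
  fixes t k a b c x :: "'a::field"
  defines "q0 \<equiv> sq0 t a b c" and "q1 \<equiv> sq1 t a b c" and "q2 \<equiv> sq2 t a b c"
  assumes k: "k \<noteq> 0" and t: "t \<noteq> 0"
    and cls: "(q0 - t * q2 = k^2 \<and> q1 + q0 = 0 \<and> q2 + q1 + t * q2 = 0 \<and> x = t) \<or>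
      (q0 + t * q2 = k^2 \<and> q1 - q0 = 0 \<and> q2 - q1 - t * q2 = 0 \<and> x = - t) \<or>
      (q0 + t * (q1 + t * q2) = k^2 \<and> q1 + t * q2 = 0 \<and> q2 - q0 - t * (q1 + t * q2) = 0 \<and> x = 0)"
  shows "doubled_x t x"
proof (rule doubled_x_of_square[OF t])
  \<comment> \<open>The coordinates of s(a + bs + cs^2), reduced by s^3 = ts^2 - t; divided by
    \<open>k\<close> they give the square root of x - theta.\<close>
  define A B C where "A = - t * c" and "B = a" and "C = b + t * c"
  have "A^2 - 2 * t * B * C - t^2 * C^2 = x * k^2"
    using cls k t unfolding q0_def q1_def q2_def sq_defs A_def B_def C_def by (elim disjE conjE) algebra+
  then show "sq0 t (A/k) (B/k) (C/k) = x"
    using k by (simp add: sq_defs field_simps power2_eq_square)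
  have "2 * A * B - t * C^2 = - t * k^2"
    using cls k t unfolding q0_def q1_def q2_def sq_defs A_def B_def C_def by (elim disjE conjE) algebra+
  then show "sq1 t (A/k) (B/k) (C/k) = - t"
    using k by (simp add: sq_defs field_simps power2_eq_square)
  have "B^2 + 2 * A * C + 2 * t * B * C + t^2 * C^2 = k^2"
    using cls k t unfolding q0_def q1_def q2_def sq_defs A_def B_def C_def by (elim disjE conjE) algebra+
  then show "sq2 t (A/k) (B/k) (C/k) = 1"
    using k by (simp add: sq_defs field_simps power2_eq_square)
qed

section \<open>The cubic field as a rational function field\<close>

text \<open>The variable: $t$ in $\mathbb Q[t]$, but $s$ in $\mathbb Q[s]$.\<close>

abbreviation X_pol :: "rat poly" where "X_pol \<equiv> [:0, 1:]"

definition wpol :: "rat poly" where "wpol = [:-1, 0, 1:]"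

text \<open>For $\deg f \le n$ this is $(s^2-1)^n f(s^3/(s^2-1))$, a polynomial in $s$.\<close>

definition homog :: "nat \<Rightarrow> rat poly \<Rightarrow> rat poly" where
  "homog n f = (\<Sum>i\<le>n. smult (coeff f i) ([:0, 1:] ^ (3 * i) * wpol ^ (n - i)))"

definition tpar :: "'a::field \<Rightarrow> 'a" where "tpar s = s^3 / (s^2 - 1)"

section \<open>Rational polynomials over the complex numbers\<close>

abbreviation cpoly :: "rat poly \<Rightarrow> complex poly" where "cpoly \<equiv> map_poly of_rat"

lemma cpoly_add: "cpoly (p + q) = cpoly p + cpoly q"
  by (rule poly_eqI) (simp add: coeff_map_poly of_rat_add)
lemma cpoly_diff: "cpoly (p - q) = cpoly p - cpoly q"
  by (rule poly_eqI) (simp add: coeff_map_poly of_rat_diff)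
lemma cpoly_mult: "cpoly (p * q) = cpoly p * cpoly q"
  by (rule poly_eqI) (simp add: coeff_map_poly coeff_mult of_rat_sum of_rat_mult)
lemma cpoly_1 [simp]: "cpoly 1 = 1"
  by (rule poly_eqI) (simp add: coeff_map_poly)
lemma cpoly_power: "cpoly (p ^ n) = cpoly p ^ n"
  by (induction n) (simp_all add: cpoly_mult)
lemma cpoly_smult: "cpoly (smult c p) = smult (of_rat c) (cpoly p)"
  by (rule poly_eqI) (simp add: coeff_map_poly of_rat_mult)
lemma cpoly_sum: "cpoly (\<Sum>i\<in>A. f i) = (\<Sum>i\<in>A. cpoly (f i))"
  by (induction A rule: infinite_finite_induct) (simp_all add: cpoly_add)
lemmas cpoly_simps = cpoly_add cpoly_diff cpoly_mult cpoly_power cpoly_smult cpoly_sum map_poly_pCons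

lemma poly_as_sum_le:
  fixes f :: "'a::comm_semiring_1 poly"
  assumes "degree f \<le> n"
  shows "poly f x = (\<Sum>i\<le>n. coeff f i * x ^ i)"
  unfolding poly_altdef
  by (rule sum.mono_neutral_left) (use assms in \<open>auto simp: coeff_eq_0\<close>)

lemma poly_homog:
  assumes "degree f \<le> n" "s^2 \<noteq> 1"
  shows "poly (homog n f) s = (s^2 - 1)^n * poly f (tpar s)"
proof -
  have w: "poly wpol s = s^2 - 1" by (simp add: wpol_def power2_eq_square)
  have "poly f (tpar s) = (\<Sum>i\<le>n. coeff f i * tpar s ^ i)"
    using assms(1) by (rule poly_as_sum_le)
  moreover have "coeff f i * (s ^ (3*i) * (s^2-1)^(n-i)) = (s^2-1)^n * (coeff f i * tpar s ^ i)" if "i \<le> n" for i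
    using that assms(2) unfolding tpar_def power_divide power_mult by (simp add: power_diff)
  moreover have "poly (homog n f) s = (\<Sum>i\<le>n. coeff f i * (s ^ (3*i) * (s^2-1)^(n-i)))"
    by (simp add: homog_def poly_sum w)
  ultimately show ?thesis
    by (simp only: sum_distrib_left) (rule sum.cong, auto)
qed

lemma poly_cpoly_homog:
  assumes "degree f \<le> n" "s^2 \<noteq> 1"
  shows "poly (cpoly (homog n f)) s = (s^2 - 1)^n * poly (cpoly f) (tpar s)"
proof -
  have w: "poly (cpoly wpol) s = s^2 - 1" by (simp add: wpol_def map_poly_pCons power2_eq_square)
  have "poly (cpoly f) (tpar s) = (\<Sum>i\<le>n. coeff (cpoly f) i * tpar s ^ i)"
    using assms(1) by (intro poly_as_sum_le) (simp add: degree_map_poly)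
  moreover have "of_rat (coeff f i) * (s ^ (3*i) * (s^2-1)^(n-i)) = (s^2-1)^n * (of_rat (coeff f i) * tpar s ^ i)" if "i \<le> n" for i
    using that assms(2) unfolding tpar_def power_divide power_mult by (simp add: power_diff)
  moreover have "poly (cpoly (homog n f)) s = (\<Sum>i\<le>n. of_rat (coeff f i) * (s ^ (3*i) * (s^2-1)^(n-i)))"
    by (simp add: homog_def cpoly_simps poly_sum w)
  ultimately show ?thesis
    by (simp only: sum_distrib_left coeff_map_poly of_rat_0) (rule sum.cong, auto)
qed

text \<open>Infinitely many rationals remain besides the poles 1 and -1 of \<open>tpar\<close>, so
  identities in Q[s] can be checked by substituting t = \<open>tpar s\<close>.\<close>

lemma poly_eqI_off_pm1:
  fixes A B :: "rat poly"
  assumes "\<And>s. s^2 \<noteq> 1 \<Longrightarrow> poly A s = poly B s"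
  shows "A = B"
proof (rule ccontr)
  assume "A \<noteq> B"
  then have "finite {s. poly (A - B) s = 0}" by (intro poly_roots_finite) simp
  moreover have "UNIV - {1, -1} \<subseteq> {s. poly (A - B) s = 0}"
    using assms by (auto simp: power2_eq_1_iff)
  ultimately have "finite (UNIV - {1, -1 :: rat})" using finite_subset by blast
  then show False by (simp add: infinite_UNIV_char_0)
qed

text \<open>Modulo $s^3$ only the summand for $k = 0$ survives.\<close>

lemma homog_coeffs_independent:
  fixes a :: "nat \<Rightarrow> rat poly"
  assumes "\<And>k. degree (a k) \<le> 2"
    and "(\<Sum>k\<le>n. a k * ([:0, 1:] ^ (3 * k) * wpol ^ (n - k))) = 0"
  shows "k \<le> n \<Longrightarrow> a k = 0"
  using assms
proof (induction n arbitrary: a k)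
  case 0
  then show ?case by simp
next
  case (Suc n)
  let ?S = "\<Sum>k\<le>n. a (Suc k) * ([:0, 1:] ^ (3 * k) * wpol ^ (n - k))"
  have "(\<Sum>k\<le>n. a (Suc k) * ([:0, 1:] ^ (3 * Suc k) * wpol ^ (Suc n - Suc k))) = [:0,1:]^3 * ?S"
    by (simp add: sum_distrib_left power_add algebra_simps)
  then have s: "a 0 * wpol ^ Suc n + [:0,1:]^3 * ?S = 0"
    using Suc.prems(3) by (simp only: sum.atMost_Suc_shift) (simp del: power_Suc)
  have "[:0,1:]^3 dvd a 0 * wpol ^ Suc n"
  proof -
    have "a 0 * wpol ^ Suc n = [:0,1:]^3 * (- ?S)" using s by (simp add: eq_neg_iff_add_eq_0 del: power_Suc)
    then show ?thesis by (simp only: dvd_triv_left)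
  qed
  moreover have "coprime ([:0,1:]^3) (wpol ^ Suc n)"
  proof -
    have "[:0,1:] * [:0,1:] + (-1) * wpol = 1" by (simp add: wpol_def one_pCons)
    then have "coprime [:0,1:] wpol"
      by (intro coprimeI) (metis dvd_add dvd_mult)
    then show ?thesis by (simp add: coprime_power_left_iff coprime_power_right_iff del: power_Suc)
  qed
  ultimately have "[:0,1:]^3 dvd a 0" by (simp add: coprime_dvd_mult_left_iff)
  then have a0: "a 0 = 0"
    using Suc.prems(2)[of 0] by (metis dvd_imp_degree_le degree_linear_power not_less_eq_eq numeral_2_eq_2 numeral_3_eq_3 order_trans)
  with s have "?S = 0" by simp
  then have "a (Suc j) = 0" if "j \<le> n" for j
    using Suc.IH[of j "\<lambda>k. a (Suc k)"] Suc.prems(2) that by blast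
  with a0 Suc.prems(1) show ?case by (cases k) auto
qed

text \<open>Multiplying the relation by (s^2-1)^n collects the three coefficients of t^k into one
  digit \<open>a k\<close> of degree at most 2, and \<open>homog_coeffs_independent\<close> makes
  every digit vanish.\<close>

lemma basis_independent:
  fixes u0 u1 u2 :: "rat poly"
  assumes "\<And>s. s^2 \<noteq> 1 \<Longrightarrow> poly u0 (tpar s) + poly u1 (tpar s) * s + poly u2 (tpar s) * s^2 = 0"
  shows "u0 = 0 \<and> u1 = 0 \<and> u2 = 0"
proof -
  define n where "n = max (degree u0) (max (degree u1) (degree u2))"
  define a where "a k = [:coeff u0 k, coeff u1 k, coeff u2 k:]" for k
  have d: "degree u0 \<le> n" "degree u1 \<le> n" "degree u2 \<le> n" by (auto simp: n_def)
  have "(\<Sum>k\<le>n. a k * ([:0, 1:] ^ (3 * k) * wpol ^ (n - k))) =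
        homog n u0 + homog n u1 * [:0,1:] + homog n u2 * [:0,1:]^2"
    unfolding homog_def sum_distrib_right sum.distrib[symmetric]
  proof (rule sum.cong[OF refl])
    fix k
    let ?m = "[:0, 1:] ^ (3 * k) * wpol ^ (n - k)"
    have "a k = [:coeff u0 k:] + [:coeff u1 k:] * [:0,1:] + [:coeff u2 k:] * [:0,1:]^2"
      by (simp add: a_def power2_eq_square)
    then show "a k * ?m = smult (coeff u0 k) ?m + smult (coeff u1 k) ?m * [:0,1:] + smult (coeff u2 k) ?m * [:0,1:]^2"
      by (simp add: algebra_simps)
  qed
  also have "\<dots> = 0"
  proof (rule poly_eqI_off_pm1)
    fix s :: rat assume s: "s^2 \<noteq> 1"
    have "poly (homog n u0 + homog n u1 * [:0,1:] + homog n u2 * [:0,1:]^2) s =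
      (s^2-1)^n * (poly u0 (tpar s) + poly u1 (tpar s) * s + poly u2 (tpar s) * s^2)"
      by (simp add: poly_homog d s algebra_simps)
    then show "poly (homog n u0 + homog n u1 * [:0,1:] + homog n u2 * [:0,1:]^2) s = poly 0 s"
      by (simp add: assms s)
  qed
  finally have "a k = 0" if "k \<le> n" for k
    using homog_coeffs_independent[of a n k] that by (simp add: a_def)
  then have "coeff u0 k = 0 \<and> coeff u1 k = 0 \<and> coeff u2 k = 0" for k
    using d by (cases "k \<le> n") (auto simp: a_def coeff_eq_0)
  then show ?thesis by (auto intro!: poly_eqI)
qed

text \<open>Since theta = 1 + 1/(s^2-1), the inverse of s^2-1 is theta - 1, an element of Q[t][s].
  Inverting s^2-1 therefore does not leave that ring.\<close>

lemma tpar_cubic: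
  assumes "s^2 \<noteq> (1::'a::field)"
  shows "s^3 = tpar s * s^2 - tpar s" "1 / (s^2 - 1) = tpar s * s - s^2 - 1"
proof -
  have w: "s^2 - 1 \<noteq> 0" and t: "tpar s * (s^2 - 1) = s^3" using assms by (simp_all add: tpar_def)
  show "s^3 = tpar s * s^2 - tpar s" using t by (simp add: algebra_simps)
  have "(tpar s * s - s^2 - 1) * (s^2 - 1) = 1" using t by algebra
  then show "1 / (s^2 - 1) = tpar s * s - s^2 - 1" using w by (simp add: divide_eq_eq)
qed

lemma basis_span_poly:
  "\<exists>u0 u1 u2. \<forall>s. s^2 \<noteq> 1 \<longrightarrow> 
    poly (g::rat poly) s = poly u0 (tpar s) + poly u1 (tpar s) * s + poly u2 (tpar s) * s^2"
proof (induction g)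
  case 0
  show ?case by (intro exI[of _ 0]) simp
next
  case (pCons c g)
  then obtain u0 u1 u2 where u: "s^2 \<noteq> 1 \<Longrightarrow>
    poly g s = poly u0 (tpar s) + poly u1 (tpar s) * s + poly u2 (tpar s) * s^2" for s by blast
  show ?case
  \<comment> \<open>Horner's scheme: the coordinates of c + s(u0 + u1 s + u2 s^2) after reducing
    s^3.\<close>
  proof (rule exI[of _ "[:c:] - [:0,1:] * u2"], rule exI[of _ u0], rule exI[of _ "u1 + [:0,1:] * u2"], intro allI impI)
    fix s :: rat assume s: "s^2 \<noteq> 1"
    show "poly (pCons c g) s = poly ([:c:] - [:0,1:] * u2) (tpar s) + poly u0 (tpar s) * s + poly (u1 + [:0,1:] * u2) (tpar s) * s^2"
      using u[OF s] tpar_cubic(1)[OF s] by simp algebra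
  qed
qed

text \<open>Together with \<open>basis_independent\<close> this makes 1, s, s^2 a basis of
  Q[s, 1/(s^2-1)] over Q[t], so that identities there can be compared coordinatewise.\<close>

lemma basis_span:
  "\<exists>u0 u1 u2. \<forall>s. s^2 \<noteq> 1 \<longrightarrow> 
    poly (g::rat poly) s / (s^2 - 1)^n = poly u0 (tpar s) + poly u1 (tpar s) * s + poly u2 (tpar s) * s^2"
proof (induction n)
  case 0
  show ?case using basis_span_poly by simp
next
  case (Suc n)
  then obtain u0 u1 u2 where u: "s^2 \<noteq> 1 \<Longrightarrow>
    poly g s / (s^2 - 1)^n = poly u0 (tpar s) + poly u1 (tpar s) * s + poly u2 (tpar s) * s^2" for s by blast
  let ?t = "[:0,1:]"
  show ?case
  \<comment> \<open>Coordinates after multiplication by ts - s^2 - 1, which sends s to t - s and s^2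
    to ts - s^2.\<close>
  proof (rule exI[of _ "?t * u1 - u0"], rule exI[of _ "?t * u0 - u1 + ?t * u2"], rule exI[of _ "- u0 - u2"], intro allI impI)
    fix s :: rat assume s: "s^2 \<noteq> 1"
    have "poly g s / (s^2 - 1)^Suc n = poly g s / (s^2 - 1)^n * (1 / (s^2 - 1))" by simp
    then show "poly g s / (s^2 - 1)^Suc n = poly (?t * u1 - u0) (tpar s) + poly (?t * u0 - u1 + ?t * u2) (tpar s) * s + poly (- u0 - u2) (tpar s) * s^2"
      unfolding u[OF s] tpar_cubic(2)[OF s] using tpar_cubic(1)[OF s] by simp algebra
  qed
qed

section \<open>The 2-descent\<close>

text \<open>The point $(p/d^2, r/d^3)$ in lowest terms.\<close>

definition primitive_point :: "rat poly \<Rightarrow> rat poly \<Rightarrow> rat poly \<Rightarrow> bool" where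
  "primitive_point p d r \<longleftrightarrow> d \<noteq> 0 \<and> coprime p d \<and> r^2 = p^3 - X_pol^2 * p * d^4 + X_pol^2 * d^6"

text \<open>With \<open>c\<close> the gcd, the cofactor \<open>e1\<close> of \<open>e\<close> is
  coprime to that of \<open>x\<close>, so it divides \<open>c\<close> and its square divides
  \<open>e\<close>; hence it is a unit.\<close>

lemma squarefree_dvd_square:
  fixes e x :: "'a::factorial_ring_gcd"
  assumes "squarefree e" "e dvd x^2"
  shows "e dvd x"
proof -
  have e: "e \<noteq> 0" using assms(1) by auto
  define c where "c = gcd e x"
  have c: "c \<noteq> 0" using e by (simp add: c_def)
  obtain e1 x1 where ex: "e = c * e1" "x = c * x1"
    unfolding c_def by (metis gcd_dvd1 gcd_dvd2 dvdE)
  have "coprime e1 x1"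
    using gcd_coprime[of e x e1 x1] c ex unfolding c_def by (simp add: mult.commute)
  moreover have "c * e1 dvd c * (c * x1^2)" using assms(2) by (simp add: ex power2_eq_square algebra_simps)
  then have "e1 dvd c * x1^2" using c by simp
  ultimately have "e1 dvd c" by (simp add: coprime_dvd_mult_left_iff)
  then have "e1^2 dvd e" by (simp add: ex power2_eq_square mult_dvd_mono)
  then have "e1 dvd 1" using assms(1) squarefreeD by blast
  then show ?thesis unfolding ex by (metis dvd_refl mult_dvd_mono one_dvd mult.right_neutral dvd_trans dvd_mult_left mult_dvd_mono)
qed

lemma coprime_poly_bezout:
  assumes "coprime p (d::rat poly)"
  obtains u v where "u * p + v * d = 1"
  using assms bezout_coefficients[of p d] by (metis coprime_iff_gcd_eq_1 surj_pair)

lemma degree_X_pol_sq [simp]: "degree (X_pol^2) = 2"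
  by (simp add: power2_eq_square)

text \<open>As \<open>m\<close> bounds the degrees of \<open>p\<close> and of t d^2, every term in
  the equation for r^2 has degree at most \<open>3 * m\<close>.\<close>

lemma primitive_point_degree_r:
  assumes "primitive_point p d r" "degree p \<le> m" "2 * degree d + 1 \<le> m"
  shows "2 * degree r \<le> 3 * m"
proof -
  have "degree (p^3) \<le> 3 * m" using degree_power_le[of p 3] assms(2) by linarith
  moreover have "degree (X_pol^2 * p * d^4) \<le> 3 * m"
    using degree_mult_le[of "X_pol^2 * p" "d^4"] degree_mult_le[of "X_pol^2" p] degree_power_le[of d 4] assms(2,3)
    unfolding degree_X_pol_sq by linarith
  moreover have "degree (X_pol^2 * d^6) \<le> 3 * m"
    using degree_mult_le[of "X_pol^2" "d^6"] degree_power_le[of d 6] assms(2,3)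
    unfolding degree_X_pol_sq by linarith
  ultimately have "degree (r^2) \<le> 3 * m"
    using assms(1) unfolding primitive_point_def by (simp add: degree_add_le degree_diff_le)
  then show ?thesis by (cases "r = 0") (auto simp: degree_power_eq)
qed

text \<open>
  Up to powers of $s^2-1$, these are $p - \theta d^2$ and the cofactor in the factorisation of $r^2 = d^6 f(p/d^2)$.
\<close>

definition Fpol :: "nat \<Rightarrow> rat poly \<Rightarrow> rat poly \<Rightarrow> rat poly" where
  "Fpol n p d = wpol * homog (2*n) p - X_pol^2 * homog n d ^ 2"

definition Hpol :: "nat \<Rightarrow> rat poly \<Rightarrow> rat poly \<Rightarrow> rat poly" where
  "Hpol n p d = wpol * homog (2*n) p ^ 2 + X_pol^2 * homog (2*n) p * homog n d ^ 2 - X_pol^4 * homog n d ^ 4"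

text \<open>This is f(x) = (x - theta)(x^2 + theta x + theta^2 - t^2) with theta^2 - t^2 =
  -s^4/(s^2-1), cleared of denominators. \<open>Fpol\<close> and \<open>Hpol\<close> each carry one
  extra factor s^2-1, which the \<open>+ 1\<close> in the index on the right accounts for.\<close>

lemma F_times_H:
  assumes pp: "primitive_point p d r" and n: "degree d \<le> n" "degree p \<le> 2 * n"
  shows "Fpol n p d * Hpol n p d = homog (3*n+1) r ^ 2"
proof (rule poly_eqI_off_pm1)
  have r: "degree r \<le> 3 * n + 1"
    using primitive_point_degree_r[OF pp, of "2 * n + 1"] n by simp
  fix s :: rat assume s: "s^2 \<noteq> 1"
  define w a b c t W where "w = s^2 - 1" and "a = poly p (tpar s)" and "b = poly d (tpar s)"
    and "c = poly r (tpar s)" and "t = tpar s" and "W = w^n"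
  have "poly (r^2) (tpar s) = poly (p^3 - X_pol^2 * p * d^4 + X_pol^2 * d^6) (tpar s)"
    using pp by (simp add: primitive_point_def)
  then have c: "c^2 = a^3 - t^2 * a * b^4 + t^2 * b^6"
    by (simp add: a_def b_def c_def t_def)
  have t: "t * w = s^3" using s by (simp add: t_def w_def tpar_def)
  have W: "w^(2*n) = W^2" "w^(3*n+1) = W^3 * w"
    by (simp_all add: W_def power_mult[symmetric] mult.commute)
  have P: "poly (homog (2*n) p) s = W^2 * a" "poly (homog n d) s = W * b" "poly (homog (3*n+1) r) s = W^3 * w * c"
    using poly_homog[OF n(2) s] poly_homog[OF n(1) s] poly_homog[OF r s]
    by (simp_all only: a_def b_def c_def w_def[symmetric] W W_def[symmetric])
  have w: "poly wpol s = w" by (simp add: wpol_def w_def power2_eq_square)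
  have "(w * (W^2 * a) - s^2 * (W * b)^2) * (w * (W^2 * a)^2 + s^2 * (W^2 * a) * (W * b)^2 - s^4 * (W * b)^4) = (W^3 * w * c)^2"
  proof -
    have "(w * a - s^2 * b^2) * (w * a^2 + s^2 * a * b^2 - s^4 * b^4) = w^2 * a^3 - (s^3)^2 * a * b^4 + (s^3)^2 * b^6"
      unfolding w_def by algebra
    also have "\<dots> = w^2 * c^2" unfolding t[symmetric] c by algebra
    finally have *: "(w * a - s^2 * b^2) * (w * a^2 + s^2 * a * b^2 - s^4 * b^4) = w^2 * c^2" .
    have "(w * (W^2 * a) - s^2 * (W * b)^2) * (w * (W^2 * a)^2 + s^2 * (W^2 * a) * (W * b)^2 - s^4 * (W * b)^4)
      = W^6 * ((w * a - s^2 * b^2) * (w * a^2 + s^2 * a * b^2 - s^4 * b^4))" by algebra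
    also have "\<dots> = (W^3 * w * c)^2" unfolding * by algebra
    finally show ?thesis .
  qed
  then show "poly (Fpol n p d * Hpol n p d) s = poly (homog (3*n+1) r ^ 2) s"
    by (simp add: Fpol_def Hpol_def P w del: mult_Suc One_nat_def Suc_eq_plus1 add_Suc_right)
qed

text \<open>
  Away from $s = 0, \pm 1$ a common root has $s^2 = 3$, so $4t^2 = 27$ and the point passes through the node
  of the fibre. Differentiating the equation shows that no section does.
\<close>

lemma common_complex_root:
  assumes pp: "primitive_point p d r" and n: "degree d \<le> n" "degree p \<le> 2 * n"
    and z: "z^2 \<noteq> 1" and F: "poly (cpoly (Fpol n p d)) z = 0" and H: "poly (cpoly (Hpol n p d)) z = 0"
  shows "z = 0"
proof (rule ccontr)
  assume z0: "z \<noteq> 0"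
  define w a b t W where "w = z^2 - 1" and "a = poly (cpoly p) (tpar z)" and "b = poly (cpoly d) (tpar z)"
    and "t = tpar z" and "W = w^n"
  have w0: "w \<noteq> 0" and W0: "W \<noteq> 0" using z by (auto simp: w_def W_def)
  have W: "w^(2*n) = W^2" by (simp add: W_def power_mult[symmetric] mult.commute)
  have P: "poly (cpoly (homog (2*n) p)) z = W^2 * a" "poly (cpoly (homog n d)) z = W * b"
    using poly_cpoly_homog[OF n(2) z] poly_cpoly_homog[OF n(1) z]
    by (simp_all only: a_def b_def w_def[symmetric] W W_def[symmetric])
  have w: "poly (cpoly wpol) z = w" by (simp add: wpol_def w_def map_poly_pCons power2_eq_square)
  have "w * (W^2 * a) - z^2 * (W * b)^2 = 0"
    using F unfolding Fpol_def cpoly_diff cpoly_mult cpoly_power poly_diff poly_mult poly_power P w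
    by (simp add: map_poly_pCons)
  then have "W^2 * (w * a - z^2 * b^2) = 0" by algebra
  then have Fe: "w * a = z^2 * b^2" using W0 by simp
  have "w * (W^2 * a)^2 + z^2 * (W^2 * a) * (W * b)^2 - z^4 * (W * b)^4 = 0"
    using H unfolding Hpol_def cpoly_diff cpoly_add cpoly_mult cpoly_power poly_diff poly_add poly_mult poly_power P w
    by (simp add: map_poly_pCons)
  then have "W^4 * (w * a^2 + z^2 * a * b^2 - z^4 * b^4) = 0" by algebra
  then have He: "w * a^2 + z^2 * a * b^2 - z^4 * b^4 = 0" using W0 by simp
  obtain u v where "u * p + v * d = 1" using pp coprime_poly_bezout unfolding primitive_point_def by blast
  then have "poly (cpoly (u * p + v * d)) t = 1" by simp
  then have "\<not> (a = 0 \<and> b = 0)" by (auto simp: cpoly_simps a_def b_def t_def)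
  then have b0: "b \<noteq> 0" using Fe w0 by auto
  \<comment> \<open>\<open>w\<close> times \<open>He\<close>, with \<open>w * a\<close> replaced by
    means of \<open>Fe\<close>.\<close>
  have "z^4 * b^4 * (2 - w) = 0" using Fe He by algebra
  then have w2: "w = 2" using z0 b0 by simp
  then have z3: "z^2 = 3" by (simp add: w_def)
  have a: "2 * a = 3 * b^2" using Fe w2 z3 by simp
  have tz: "2 * t = z^3" using w2 by (simp add: t_def tpar_def w_def)
  then have t2: "4 * t^2 = 27" using z3 by algebra
  define pc dc rc T where "pc = cpoly p" and "dc = cpoly d" and "rc = cpoly r" and "T = cpoly X_pol"
  have T: "T = [:0, 1:]" by (simp add: T_def map_poly_pCons)
  have eq: "rc^2 = pc^3 - T^2 * pc * dc^4 + T^2 * dc^6"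
    using pp unfolding primitive_point_def pc_def dc_def rc_def T_def by (metis cpoly_add cpoly_diff cpoly_mult cpoly_power)
  have r: "poly rc t = 0"
  proof -
    have "(poly rc t)^2 = poly (pc^3 - T^2 * pc * dc^4 + T^2 * dc^6) t" unfolding eq[symmetric] by simp
    also have "\<dots> = a^3 - t^2 * a * b^4 + t^2 * b^6" by (simp add: T pc_def dc_def a_def b_def t_def)
    finally have e: "(poly rc t)^2 = a^3 - t^2 * a * b^4 + t^2 * b^6" .
    have "8 * (poly rc t)^2 = 0" unfolding e using a t2 by algebra
    then show ?thesis by simp
  qed
  define p' d' r' where "p' = poly (pderiv pc) t" and "d' = poly (pderiv dc) t" and "r' = poly (pderiv rc) t"
  have "poly (pderiv (rc * rc)) t = poly (pderiv (pc * pc * pc - T * T * pc * (dc * dc * dc * dc) + T * T * (dc * dc * dc * dc * dc * dc))) t"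
    using eq by (simp add: power_numeral_reduce mult.assoc)
  then have "0 = 3 * a^2 * p' - (2 * t * a * b^4 + t^2 * p' * b^4 + 4 * t^2 * a * b^3 * d') + (2 * t * b^6 + 6 * t^2 * b^5 * d')"
    using r by (simp add: T pderiv_mult pderiv_add pderiv_diff pderiv_pCons
      p'_def d'_def pc_def[symmetric] dc_def[symmetric] a_def b_def t_def[symmetric] algebra_simps power_numeral_reduce)
  \<comment> \<open>At the node the coefficients of \<open>p'\<close> and \<open>d'\<close> cancel,
    and only \<open>- t * b^6\<close> remains.\<close>
  then have "t * b^6 = 0" using a t2 by algebra
  then have "t = 0" using b0 by simp
  with t2 show False by simp
qed

section \<open>The squarefree part of \<open>Fpol\<close>: its value at 0 and its roots\<close>

lemma poly_homog_0:
  assumes "degree f \<le> n"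
  shows "poly (homog n f) 0 = (-1)^n * poly f 0"
  using poly_homog[OF assms, of 0] by (simp add: tpar_def)

lemma homog_dvd_X3:
  assumes "poly f 0 = 0"
  shows "X_pol^3 dvd homog n f"
  unfolding homog_def
proof (rule dvd_sum)
  fix i
  show "X_pol^3 dvd smult (coeff f i) (X_pol ^ (3 * i) * wpol ^ (n - i))"
  proof (cases i)
    case 0
    then show ?thesis using assms by (simp add: poly_0_coeff_0)
  next
    case (Suc j)
    then have "X_pol^(3*i) = X_pol^3 * X_pol^(3*j)" by (simp add: power_add[symmetric])
    then show ?thesis by (simp add: mult.assoc dvd_smult del: mult_pCons_left)
  qed
qed

lemma X_pol_dvd_iff: "X_pol dvd f \<longleftrightarrow> poly f 0 = 0"
  using poly_eq_0_iff_dvd[of f 0] by simp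

text \<open>This excludes the root 0 of \<open>e\<close> and pins down its constant. If p(0) is
  nonzero, then F(0) = -p(0), and r(0)^2 = p(0)^3 makes p(0) a square. If p(0) = 0, then F is s^2
  times a polynomial with value -d(0)^2 at 0, and squarefreeness of \<open>e\<close> forces that s^2
  into \<open>g^2\<close>.\<close>

lemma squarefree_part_at_0:
  assumes pp: "primitive_point p d r" and n: "degree d \<le> n" "degree p \<le> 2 * n"
    and F: "Fpol n p d = e * g^2" and e: "squarefree e"
  shows "\<exists>k. k \<noteq> 0 \<and> poly e 0 = -(k^2)"
proof (cases "poly p 0 = 0")
  case False
  have "poly (Fpol n p d) 0 = - poly p 0"
    by (simp add: Fpol_def poly_homog_0[OF n(2)] wpol_def)
  then have eg: "poly e 0 * (poly g 0)^2 = - poly p 0" by (simp add: F)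
  have "poly (r^2) 0 = poly (p^3 - X_pol^2 * p * d^4 + X_pol^2 * d^6) 0"
    using pp by (simp add: primitive_point_def)
  then have r: "(poly r 0)^2 = (poly p 0)^3" by simp
  have g0: "poly g 0 \<noteq> 0" using eg False by auto
  define k where "k = poly r 0 / (poly p 0 * poly g 0)"
  have "k \<noteq> 0" using r False g0 by (auto simp: k_def)
  moreover have "poly e 0 = -(k^2)"
  proof -
    have "k^2 = poly p 0 / (poly g 0)^2"
      unfolding k_def power_divide power_mult_distrib r using False g0 by (simp add: power2_eq_square power3_eq_cube)
    also have "\<dots> = - poly e 0" using eg g0 by (simp add: field_simps)
    finally show ?thesis by simp
  qed
  ultimately show ?thesis by blast
next
  case True
  obtain u v where "u * p + v * d = 1" using pp coprime_poly_bezout unfolding primitive_point_def by blast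
  then have "poly (u * p + v * d) 0 = 1" by simp
  then have d0: "poly d 0 \<noteq> 0" using True by auto
  obtain P1 where P1: "homog (2*n) p = X_pol^3 * P1" using homog_dvd_X3[OF True] by (meson dvdE)
  define F1 where "F1 = X_pol * wpol * P1 - homog n d ^ 2"
  have FF: "e * g^2 = X_pol^2 * F1"
    unfolding F[symmetric] Fpol_def P1 F1_def by algebra
  have F10: "poly F1 0 = -((poly d 0)^2)"
    by (simp add: F1_def poly_homog_0[OF n(1)] power_mult_distrib power_mult[symmetric] mult.commute)
  have X0: "X_pol \<noteq> 0" by simp
  have "X_pol dvd g"
  proof (rule ccontr)
    assume "\<not> X_pol dvd g"
    then have g0: "poly g 0 \<noteq> 0" by (simp add: X_pol_dvd_iff)
    have "poly (e * g^2) 0 = 0" unfolding FF by simp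
    then have "poly e 0 = 0" using g0 by simp
    then obtain e1 where e1: "e = X_pol * e1" using X_pol_dvd_iff by (meson dvdE)
    have "X_pol * (e1 * g^2) = X_pol * (X_pol * F1)" using FF unfolding e1 by algebra
    then have "e1 * g^2 = X_pol * F1" using X0 mult_left_cancel by blast
    then have "poly (e1 * g^2) 0 = 0" by simp
    then have "poly e1 0 = 0" using g0 by simp
    then have "X_pol dvd e1" using X_pol_dvd_iff by blast
    then have "X_pol^2 dvd e" unfolding e1 power2_eq_square by (rule mult_dvd_mono[OF dvd_refl])
    then have "X_pol dvd 1" using e squarefreeD by blast
    then show False by (simp add: X_pol_dvd_iff)
  qed
  then obtain g1 where g1: "g = X_pol * g1" by (meson dvdE)
  have "X_pol^2 * (e * g1^2) = X_pol^2 * F1" using FF unfolding g1 by algebra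
  then have "e * g1^2 = F1" using X0 by (metis mult_left_cancel power_not_zero)
  then have eq: "poly e 0 * (poly g1 0)^2 = -((poly d 0)^2)" using F10 by (metis poly_mult poly_power)
  then have g0: "poly g1 0 \<noteq> 0" using d0 by auto
  have "poly e 0 = -((poly d 0 / poly g1 0)^2)" using eq g0 by (simp add: field_simps power_divide)
  moreover have "poly d 0 / poly g1 0 \<noteq> 0" using d0 g0 by simp
  ultimately show ?thesis by blast
qed

text \<open>Squarefreeness limits the root 1/c to a single linear factor. The factor is normalised
  to value 1 at 0, so that constants can later be read off there.\<close>

lemma split_off_root:
  fixes e :: "rat poly"
  assumes "squarefree e" "c \<noteq> 0"
  shows "\<exists>A e1. (A = 1 \<or> A = [:1, - c:]) \<and> e = A * e1 \<and> poly e1 (1/c) \<noteq> 0"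
proof (cases "poly e (1/c) = 0")
  case False
  then show ?thesis by (intro exI[of _ 1] exI[of _ e]) simp
next
  case True
  then obtain e2 where "e = [:-(1/c), 1:] * e2" by (meson poly_eq_0_iff_dvd dvdE)
  moreover have "[:-(1/c), 1:] = smult (-(1/c)) [:1, -c:]" using assms(2) by simp
  ultimately have e: "e = [:1, -c:] * smult (-(1/c)) e2" by (simp only: mult_smult_left mult_smult_right)
  have "poly (smult (-(1/c)) e2) (1/c) \<noteq> 0"
  proof
    assume "poly (smult (-(1/c)) e2) (1/c) = 0"
    then have "[:-(1/c), 1:] dvd smult (-(1/c)) e2" using poly_eq_0_iff_dvd by blast
    moreover have "[:1, -c:] dvd [:-(1/c), 1:]"
      using \<open>[:-(1/c), 1:] = smult (-(1/c)) [:1, -c:]\<close> by (metis dvd_refl dvd_smult)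
    ultimately have "[:1, -c:]^2 dvd e" unfolding e power2_eq_square by (intro mult_dvd_mono dvd_refl) (rule dvd_trans)
    then have "[:1, -c:] dvd 1" using assms(1) squarefreeD by blast
    then show False using assms(2) by (auto simp: is_unit_poly_iff)
  qed
  with e show ?thesis by blast
qed

text \<open>Once the factors for 1 and -1 are split off, the cofactor has no complex root and is
  constant.\<close>

lemma squarefree_roots_pm1:
  fixes e :: "rat poly"
  assumes sf: "squarefree e" and roots: "\<And>z. poly (cpoly e) z = 0 \<Longrightarrow> z^2 = 1"
  shows "\<exists>c E. e = smult c E \<and> E \<in> {1, [:1,-1:], [:1,1:], [:1,0,-1:]}"
proof -
  obtain A e1 where A: "A = 1 \<or> A = [:1, -1:]" "e = A * e1" "poly e1 1 \<noteq> 0"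
    using split_off_root[OF sf, of 1] by auto
  have sf1: "squarefree e1" using sf A(2) by (metis squarefree_mono dvd_triv_right)
  obtain B e2 where B: "B = 1 \<or> B = [:1, 1:]" "e1 = B * e2" "poly e2 (-1) \<noteq> 0"
    using split_off_root[OF sf1, of "-1"] by auto
  have "poly e2 1 \<noteq> 0" using A(3) B(2) by auto
  have nr: "poly (cpoly e2) z \<noteq> 0" for z
  proof
    assume h: "poly (cpoly e2) z = 0"
    then have "poly (cpoly e) z = 0" by (simp add: A B cpoly_mult)
    then have "z^2 = 1" by (rule roots)
    then have "z = of_rat 1 \<or> z = of_rat (-1)" by (simp add: power2_eq_1_iff)
    moreover have "poly (cpoly e2) (of_rat q) = of_rat (poly e2 q)" for q
      by (induction e2) (simp_all add: map_poly_pCons of_rat_add of_rat_mult)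
    ultimately show False using h B(3) \<open>poly e2 1 \<noteq> 0\<close> by (metis of_rat_eq_0_iff)
  qed
  then have "degree (cpoly e2) = 0"
    using fundamental_theorem_of_algebra constant_degree by blast
  then have "degree e2 = 0" by (simp add: degree_map_poly)
  then obtain c where "e2 = [:c:]" by (rule degree_eq_zeroE)
  then have "e = smult c (A * B)" by (simp add: A B)
  moreover have "A * B \<in> {1, [:1,-1:], [:1,1:], [:1,0,-1:]}" using A(1) B(1) by auto
  ultimately show ?thesis by blast
qed

text \<open>As \<open>F * H\<close> is a square, the squarefree part \<open>e\<close> of
  \<open>F\<close> also divides \<open>H\<close>. By \<open>common_complex_root\<close> its only
  possible complex root besides 1 and -1 is 0, which \<open>squarefree_part_at_0\<close>
  forbids.\<close>

lemma descent_class: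
  assumes pp: "primitive_point p d r"
  shows "\<exists>E g N. E \<in> {1, [:1,-1:], [:1,1:], [:1,0,-1:]} \<and> (\<forall>s. s^2 \<noteq> 1 \<longrightarrow>
    poly p (tpar s) - s^2 / (s^2 - 1) * (poly d (tpar s))^2 = poly E s * (poly g s / (s^2 - 1)^N)^2)"
proof -
  define n where "n = degree d + degree p"
  have n: "degree d \<le> n" "degree p \<le> 2 * n" by (auto simp: n_def)
  define F H G e g where "F = Fpol n p d" and "H = Hpol n p d" and "G = homog (3*n+1) r"
    and "e = squarefree_part F" and "g = square_part F"
  have FH: "F * H = G^2" using F_times_H[OF pp n] by (simp add: F_def H_def G_def)
  have F: "F = e * g^2" unfolding e_def g_def by (rule squarefree_decompose)
  have sf: "squarefree e" by (simp add: e_def)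
  obtain k where k: "k \<noteq> 0" "poly e 0 = -(k^2)"
    using squarefree_part_at_0[OF pp n F[unfolded F_def] sf] by blast
  have eH: "e dvd H" if g: "g \<noteq> 0"
  proof -
    have "g^2 dvd G^2" unfolding FH[symmetric] F by simp
    then have "g dvd G" by simp
    then obtain G1 where G1: "G = g * G1" by (meson dvdE)
    have "g^2 * (e * H) = g^2 * G1^2" using FH unfolding F G1 by algebra
    then have eH: "e * H = G1^2" using g by simp
    then have "e dvd G1" using squarefree_dvd_square[OF sf] by (metis dvd_triv_left)
    then have "e * e dvd e * H" unfolding eH power2_eq_square by (simp add: mult_dvd_mono)
    moreover have "e \<noteq> 0" using k by auto
    ultimately show ?thesis by simp
  qed
  have "\<exists>c E. e = smult c E \<and> E \<in> {1, [:1,-1:], [:1,1:], [:1,0,-1:]}"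
  proof (rule squarefree_roots_pm1[OF sf], rule ccontr)
    fix z assume z: "poly (cpoly e) z = 0" "z^2 \<noteq> 1"
    have "poly (cpoly F) z = 0" using z by (simp add: F cpoly_mult)
    moreover have "poly (cpoly H) z = 0"
    proof (cases "g = 0")
      case True
      then have "F = 0" by (simp add: F)
      \<comment> \<open>By convention the squarefree part of 0 is 1, which has no root.\<close>
      then have "squarefree_part F = 1" by simp
      then show ?thesis using z by (simp add: e_def)
    next
      case False
      then obtain f where "H = e * f" using eH by (meson dvdE)
      then show ?thesis using z by (simp add: cpoly_mult)
    qed
    ultimately have "z = 0" using common_complex_root[OF pp n z(2)] by (simp add: F_def H_def)
    then have "of_rat (poly e 0) = (0::complex)" using z by (simp add: poly_0_coeff_0 coeff_map_poly)
    then show False using k by simp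
  qed
  then obtain c E where E: "e = smult c E" "E \<in> {1, [:1,-1:], [:1,1:], [:1,0,-1:]}" by blast
  have "c = -(k^2)" using k(2) E by auto
  \<comment> \<open>Up to squares \<open>F\<close> is both (s^2-1)(p - theta d^2) and
    -\<open>E\<close>. Hence p - theta d^2 has the class of (1-s^2)\<open>E\<close>, which is again
    one of the four classes up to the square \<open>K^2\<close>.\<close>
  have "\<exists>M K. M \<in> {1, [:1,-1:], [:1,1:], [:1,0,-1:]} \<and> [:1,0,-1:] * E = M * K^2"
    using E(2)
  proof (elim insertE emptyE)
    assume "E = 1"
    then show ?thesis by (intro exI[of _ "[:1,0,-1:]"] exI[of _ 1]) simp
  next
    assume "E = [:1,-1:]"
    then show ?thesis by (intro exI[of _ "[:1,1:]"] exI[of _ "[:1,-1:]"]) (simp add: power2_eq_square)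
  next
    assume "E = [:1,1:]"
    then show ?thesis by (intro exI[of _ "[:1,-1:]"] exI[of _ "[:1,1:]"]) (simp add: power2_eq_square)
  next
    assume "E = [:1,0,-1:]"
    then show ?thesis by (intro exI[of _ 1] exI[of _ "[:1,0,-1:]"]) (simp add: power2_eq_square)
  qed
  then obtain M K where M: "M \<in> {1, [:1,-1:], [:1,1:], [:1,0,-1:]}" and ME: "[:1,0,-1:] * E = M * K^2" by blast
  show ?thesis
  proof (rule exI[of _ "M"], rule exI[of _ "smult k (K * g)"], rule exI[of _ "n + 1"], intro conjI allI impI)
    show "M \<in> {1, [:1,-1:], [:1,1:], [:1,0,-1:]}" by (rule M)
    fix s :: rat assume s: "s^2 \<noteq> 1"
    define w a b W where "w = s^2 - 1" and "a = poly p (tpar s)" and "b = poly d (tpar s)" and "W = w^n"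
    have w0: "w \<noteq> 0" and W0: "W \<noteq> 0" using s by (auto simp: w_def W_def)
    have W: "w^(2*n) = W^2" by (simp add: W_def power_mult[symmetric] mult.commute)
    have P: "poly (homog (2*n) p) s = W^2 * a" "poly (homog n d) s = W * b"
      using poly_homog[OF n(2) s] poly_homog[OF n(1) s]
      by (simp_all only: a_def b_def w_def[symmetric] W W_def[symmetric])
    have w: "poly wpol s = w" by (simp add: wpol_def w_def power2_eq_square)
    have Fs: "poly F s = w * (W^2 * a) - s^2 * (W * b)^2"
      unfolding F_def Fpol_def poly_diff poly_mult poly_power P w by simp
    have Fs2: "poly F s = -(k^2) * poly E s * (poly g s)^2"
      unfolding F E(1) by (simp add: \<open>c = -(k^2)\<close>)
    have "poly ([:1,0,-1:] * E) s = poly (M * K ^ 2) s" by (simp only: ME)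
    then have Es: "- w * poly E s = poly M s * (poly K s)^2"
      by (simp add: w_def algebra_simps power2_eq_square)
    have "w * (w * (W^2 * a) - s^2 * (W * b)^2) = k^2 * (poly M s * (poly K s)^2) * (poly g s)^2"
      using Fs Fs2 Es by algebra
    then have "W^2 * w^2 * (a - s^2 / w * b^2) = poly M s * (k * poly K s * poly g s)^2"
      using w0 by (simp add: field_simps power2_eq_square)
    moreover have "W^2 * w^2 \<noteq> 0" using w0 W0 by simp
    ultimately have "a - s^2 / w * b^2 = poly M s * (k * poly K s * poly g s)^2 / (W^2 * w^2)"
      by (metis nonzero_mult_div_cancel_left)
    also have "\<dots> = poly M s * ((k * poly K s * poly g s) / (W * w))^2"
      by (simp only: power_divide power_mult_distrib times_divide_eq_right)
    finally show "poly p (tpar s) - s^2 / (s^2 - 1) * (poly d (tpar s))^2 =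
      poly M s * (poly (smult k (K * g)) s / (s^2 - 1)^(n+1))^2"
      unfolding a_def[symmetric] b_def[symmetric] w_def[symmetric] power_add power_one_right W_def[symmetric]
        poly_smult poly_mult mult.assoc .
  qed
qed
lemma basis_unique:
  fixes a0 a1 a2 b0 b1 b2 :: "rat poly"
  assumes "\<And>s. s^2 \<noteq> 1 \<Longrightarrow> poly a0 (tpar s) + poly a1 (tpar s) * s + poly a2 (tpar s) * s^2 =
    poly b0 (tpar s) + poly b1 (tpar s) * s + poly b2 (tpar s) * s^2"
  shows "a0 = b0 \<and> a1 = b1 \<and> a2 = b2"
proof -
  have "a0 - b0 = 0 \<and> a1 - b1 = 0 \<and> a2 - b2 = 0"
    by (rule basis_independent) (use assms in \<open>auto simp: algebra_simps\<close>)
  then show ?thesis by simp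
qed

text \<open>The four cases are $\varepsilon = 1, 1 + s, 1 - s, 1 - s^2$.\<close>

lemma descent:
  assumes pp: "primitive_point p d r"
  shows "\<exists>u0 u1 u2. let q0 = sq0 X_pol u0 u1 u2; q1 = sq1 X_pol u0 u1 u2; q2 = sq2 X_pol u0 u1 u2; D = d^2; t = X_pol in
    (q0 = p \<and> q1 = - t * D \<and> q2 = D) \<or>
    (q0 - t * q2 = p \<and> q1 + q0 = - t * D \<and> q2 + q1 + t * q2 = D) \<or>
    (q0 + t * q2 = p \<and> q1 - q0 = - t * D \<and> q2 - q1 - t * q2 = D) \<or>
    (q0 + t * (q1 + t * q2) = p \<and> q1 + t * q2 = - t * D \<and> q2 - q0 - t * (q1 + t * q2) = D)"
proof -
  obtain E g N where E: "E \<in> {1, [:1,-1:], [:1,1:], [:1,0,-1:]}" and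
    h: "\<And>s. s^2 \<noteq> 1 \<Longrightarrow> poly p (tpar s) - s^2 / (s^2 - 1) * (poly d (tpar s))^2 = poly E s * (poly g s / (s^2 - 1)^N)^2"
    using descent_class[OF pp] by blast
  obtain u0 u1 u2 where u: "\<And>s. s^2 \<noteq> 1 \<Longrightarrow>
    poly g s / (s^2 - 1)^N = poly u0 (tpar s) + poly u1 (tpar s) * s + poly u2 (tpar s) * s^2"
    using basis_span by blast
  define q0 q1 q2 t where "q0 = sq0 X_pol u0 u1 u2" and "q1 = sq1 X_pol u0 u1 u2" and "q2 = sq2 X_pol u0 u1 u2" and "t = X_pol"
  have lhs: "poly p (tpar s) + poly (- t * d^2) (tpar s) * s + poly (d^2) (tpar s) * s^2 =
    poly E s * (poly q0 (tpar s) + poly q1 (tpar s) * s + poly q2 (tpar s) * s^2)" if s: "s^2 \<noteq> 1" for s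
  proof -
    define T where "T = tpar s"
    have c: "s^3 = T * s^2 - T" unfolding T_def by (rule tpar_cubic(1)[OF s])
    have "(poly u0 T + poly u1 T * s + poly u2 T * s^2)^2 = poly q0 T + poly q1 T * s + poly q2 T * s^2"
      using c by (simp add: q0_def q1_def q2_def sq_defs) algebra
    moreover have "s^2 / (s^2 - 1) = T * s - s^2"
    proof -
      have "s^2 / (s^2 - 1) = s^2 * (T * s - s^2 - 1)"
        using tpar_cubic(2)[OF s] by (simp add: T_def divide_inverse)
      also have "\<dots> = T * s - s^2" using c by algebra
      finally show ?thesis .
    qed
    ultimately have "poly p T - (T * s - s^2) * (poly d T)^2 = poly E s * (poly q0 T + poly q1 T * s + poly q2 T * s^2)"
      using h[OF s] u[OF s] unfolding T_def[symmetric] by simp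
    then show ?thesis unfolding T_def[symmetric] by (simp add: t_def algebra_simps)
  qed
  have "(q0 = p \<and> q1 = - t * d^2 \<and> q2 = d^2) \<or>
    (q0 - t * q2 = p \<and> q1 + q0 = - t * d^2 \<and> q2 + q1 + t * q2 = d^2) \<or>
    (q0 + t * q2 = p \<and> q1 - q0 = - t * d^2 \<and> q2 - q1 - t * q2 = d^2) \<or>
    (q0 + t * (q1 + t * q2) = p \<and> q1 + t * q2 = - t * d^2 \<and> q2 - q0 - t * (q1 + t * q2) = d^2)"
    using E
  proof (elim insertE emptyE)
    assume E: "E = 1"
    have "p = q0 \<and> - t * d^2 = q1 \<and> d^2 = q2"
      by (rule basis_unique) (use lhs in \<open>simp only: E poly_1 mult_1_left\<close>)
    then show ?thesis by blast
  next
    assume E: "E = [:1,-1:]"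
    have "p = q0 + t * q2 \<and> - t * d^2 = q1 - q0 \<and> d^2 = q2 - q1 - t * q2"
    proof (rule basis_unique)
      fix s :: rat assume s: "s^2 \<noteq> 1"
      show "poly p (tpar s) + poly (- t * d^2) (tpar s) * s + poly (d^2) (tpar s) * s^2 =
        poly (q0 + t * q2) (tpar s) + poly (q1 - q0) (tpar s) * s + poly (q2 - q1 - t * q2) (tpar s) * s^2"
        unfolding lhs[OF s] using tpar_cubic(1)[OF s] by (simp add: E t_def) algebra
    qed
    then show ?thesis by metis
  next
    assume E: "E = [:1,1:]"
    have "p = q0 - t * q2 \<and> - t * d^2 = q1 + q0 \<and> d^2 = q2 + q1 + t * q2"
    proof (rule basis_unique)
      fix s :: rat assume s: "s^2 \<noteq> 1"
      show "poly p (tpar s) + poly (- t * d^2) (tpar s) * s + poly (d^2) (tpar s) * s^2 =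
        poly (q0 - t * q2) (tpar s) + poly (q1 + q0) (tpar s) * s + poly (q2 + q1 + t * q2) (tpar s) * s^2"
        unfolding lhs[OF s] using tpar_cubic(1)[OF s] by (simp add: E t_def) algebra
    qed
    then show ?thesis by metis
  next
    assume E: "E = [:1,0,-1:]"
    have "p = q0 + t * (q1 + t * q2) \<and> - t * d^2 = q1 + t * q2 \<and> d^2 = q2 - q0 - t * (q1 + t * q2)"
    proof (rule basis_unique)
      fix s :: rat assume s: "s^2 \<noteq> 1"
      show "poly p (tpar s) + poly (- t * d^2) (tpar s) * s + poly (d^2) (tpar s) * s^2 =
        poly (q0 + t * (q1 + t * q2)) (tpar s) + poly (q1 + t * q2) (tpar s) * s + poly (q2 - q0 - t * (q1 + t * q2)) (tpar s) * s^2"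
        unfolding lhs[OF s] using tpar_cubic(1)[OF s] by (simp add: E t_def) algebra
    qed
    then show ?thesis by metis
  qed
  then show ?thesis unfolding q0_def q1_def q2_def t_def Let_def by blast
qed

section \<open>Values of rational functions\<close>

text \<open>The relation behind \<open>eval_at\<close>, without the choice operator, so that values
  pass through field operations.\<close>

definition has_value_at :: "rat \<Rightarrow> ratfun \<Rightarrow> rat \<Rightarrow> bool" where
  "has_value_at a f c \<longleftrightarrow> (\<exists>p q. poly q a \<noteq> 0 \<and> f = Fract p q \<and> c = poly p a / poly q a)"

lemma has_value_at_unique:
  assumes "has_value_at a f c" "has_value_at a f c'"
  shows "c = c'"
proof -
  obtain p q where 1: "poly q a \<noteq> 0" "f = Fract p q" "c = poly p a / poly q a"
    using assms(1) by (auto simp: has_value_at_def)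
  obtain p' q' where 2: "poly q' a \<noteq> 0" "f = Fract p' q'" "c' = poly p' a / poly q' a"
    using assms(2) by (auto simp: has_value_at_def)
  have "q \<noteq> 0" "q' \<noteq> 0" using 1 2 by auto
  then have "p * q' = p' * q" using 1 2 eq_fract(1) by metis
  then have "poly p a * poly q' a = poly p' a * poly q a" by (metis poly_mult)
  then show ?thesis using 1 2 by (simp add: frac_eq_eq)
qed

lemma regular_at_iff: "regular_at a f \<longleftrightarrow> (\<exists>c. has_value_at a f c)"
  by (auto simp: regular_at_def has_value_at_def)

lemma eval_at_eq: "has_value_at a f c \<Longrightarrow> eval_at a f = c"
  unfolding eval_at_def has_value_at_def[symmetric]
  by (rule some_equality) (auto intro: has_value_at_unique)

lemma has_value_at_to_fract: "has_value_at a (to_fract p) (poly p a)"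
  unfolding has_value_at_def to_fract_def by (intro exI[of _ p] exI[of _ 1]) simp

lemma has_value_at_add:
  assumes "has_value_at a f c" "has_value_at a g e"
  shows "has_value_at a (f + g) (c + e)"
proof -
  obtain p q where 1: "poly q a \<noteq> 0" "f = Fract p q" "c = poly p a / poly q a"
    using assms(1) by (auto simp: has_value_at_def)
  obtain p' q' where 2: "poly q' a \<noteq> 0" "g = Fract p' q'" "e = poly p' a / poly q' a"
    using assms(2) by (auto simp: has_value_at_def)
  have "q \<noteq> 0" "q' \<noteq> 0" using 1 2 by auto
  then show ?thesis unfolding has_value_at_def using 1 2
    by (intro exI[of _ "p * q' + p' * q"] exI[of _ "q * q'"]) (simp add: add_frac_eq)
qed

lemma has_value_at_mult:
  assumes "has_value_at a f c" "has_value_at a g e"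
  shows "has_value_at a (f * g) (c * e)"
proof -
  obtain p q where 1: "poly q a \<noteq> 0" "f = Fract p q" "c = poly p a / poly q a"
    using assms(1) by (auto simp: has_value_at_def)
  obtain p' q' where 2: "poly q' a \<noteq> 0" "g = Fract p' q'" "e = poly p' a / poly q' a"
    using assms(2) by (auto simp: has_value_at_def)
  show ?thesis unfolding has_value_at_def using 1 2
    by (intro exI[of _ "p * p'"] exI[of _ "q * q'"]) simp
qed

lemma has_value_at_inverse:
  assumes "has_value_at a f c" "c \<noteq> 0"
  shows "has_value_at a (inverse f) (inverse c)"
proof -
  obtain p q where 1: "poly q a \<noteq> 0" "f = Fract p q" "c = poly p a / poly q a"
    using assms(1) by (auto simp: has_value_at_def)
  show ?thesis unfolding has_value_at_def using 1 assms(2)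
    by (intro exI[of _ q] exI[of _ p]) simp
qed

lemma to_fract_numeral: "to_fract (numeral k) = numeral k"
  by (metis Fract_of_nat_eq of_nat_numeral to_fract_def)

lemma has_value_at_numeral: "has_value_at a (numeral k) (numeral k)"
  using has_value_at_to_fract[of a "numeral k"] by (simp add: to_fract_numeral)

lemma has_value_at_uminus: "has_value_at a f c \<Longrightarrow> has_value_at a (- f) (- c)"
  using has_value_at_mult[OF _ has_value_at_to_fract[of a "-1"]] by fastforce

lemma has_value_at_diff:
  "has_value_at a f c \<Longrightarrow> has_value_at a g e \<Longrightarrow> has_value_at a (f - g) (c - e)"
  using has_value_at_add[OF _ has_value_at_uminus] by fastforce

lemma has_value_at_power: "has_value_at a f c \<Longrightarrow> has_value_at a (f ^ n) (c ^ n)"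
proof (induction n)
  case 0
  show ?case using has_value_at_to_fract[of a 1] by simp
qed (auto intro: has_value_at_mult)

lemma has_value_at_divide:
  "has_value_at a f c \<Longrightarrow> has_value_at a g e \<Longrightarrow> e \<noteq> 0 \<Longrightarrow> has_value_at a (f / g) (c / e)"
  unfolding divide_inverse by (intro has_value_at_mult has_value_at_inverse)

section \<open>Points in lowest terms\<close>

lemma tvar_conv: "tvar = to_fract X_pol"
  by (simp add: tvar_def to_fract_def)

lemma has_value_at_tvar: "has_value_at a tvar a"
  unfolding tvar_conv using has_value_at_to_fract[of a X_pol] by simp

lemmas has_value_at_intros = has_value_at_add has_value_at_mult has_value_at_diff
  has_value_at_power has_value_at_tvar has_value_at_numeral

lemma to_fract_power: "to_fract (p ^ n) = to_fract p ^ n"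
  by (induction n) simp_all

text \<open>For x = p/q and y = u/v in lowest terms the equation reads u^2 q^3 = v^2 f, with q
  coprime to f and u to v. Hence v^2 = q^3, so q is the square of d = v/q, and v = d^3.\<close>

lemma primitive_representation:
  assumes "y^2 = x^3 - tvar^2 * x + tvar^2"
  shows "\<exists>p d r. primitive_point p d r \<and> x = to_fract p / to_fract d ^ 2 \<and> y = to_fract r / to_fract d ^ 3"
proof -
  define p q u v where "p = fst (quot_of_fract x)" and "q = snd (quot_of_fract x)"
    and "u = fst (quot_of_fract y)" and "v = snd (quot_of_fract y)"
  have x: "x = to_fract p / to_fract q" and y: "y = to_fract u / to_fract v"
    by (simp_all add: p_def q_def u_def v_def flip: Fract_conv_to_fract)
  have co: "coprime p q" "coprime u v"
    by (simp_all add: p_def q_def u_def v_def coprime_quot_of_fract)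
  have nm: "normalize q = q" "normalize v = v"
    by (simp_all add: q_def v_def normalize_snd_quot_of_fract)
  have nz: "q \<noteq> 0" "v \<noteq> 0" by (simp_all add: q_def v_def)
  define f where "f = p^3 - X_pol^2 * p * q^2 + X_pol^2 * q^3"
  have "U^2 * Q^3 = V^2 * (P^3 - T^2 * P * Q^2 + T^2 * Q^3)"
    if "(U / V)^2 = (P / Q)^3 - T^2 * (P / Q) + T^2" "Q \<noteq> 0" "V \<noteq> 0" for U V P Q T :: ratfun
    using that by (simp add: power_divide field_simps power2_eq_square power3_eq_cube)
  from this[OF assms[unfolded x y]] have "to_fract (u^2 * q^3) = to_fract (v^2 * f)"
    using nz unfolding f_def tvar_conv to_fract_mult to_fract_diff to_fract_add to_fract_power by simp
  then have eq: "u^2 * q^3 = v^2 * f" by (simp only: to_fract_eq_iff)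
  have cf: "coprime q f"
  proof (rule coprimeI)
    fix c assume c: "c dvd q" "c dvd f"
    have "p^3 = f + q * (X_pol^2 * p * q - X_pol^2 * q^2)" unfolding f_def by algebra
    then have "c dvd p^3" using c by simp
    moreover have "coprime (p^3) q" using co by simp
    ultimately show "c dvd 1" using c coprime_common_divisor by blast
  qed
  have "q^3 dvd v^2 * f" unfolding eq[symmetric] by simp
  moreover have "coprime (q^3) f" using cf by simp
  ultimately have 1: "q^3 dvd v^2" by (simp add: coprime_dvd_mult_left_iff)
  have "v^2 dvd q^3 * u^2" unfolding mult.commute[of "q^3"] eq by simp
  moreover have "coprime (v^2) (u^2)" using co by (simp add: coprime_commute)
  ultimately have 2: "v^2 dvd q^3" by (simp add: coprime_dvd_mult_left_iff)
  \<comment> \<open>Both denominators are normalised, so the two divisibilities give equality and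
    not just equality up to a unit.\<close>
  have vq: "v^2 = q^3"
    using associated_eqI[OF 2 1] nm by (simp add: normalize_power)
  then have "q^2 dvd v^2" by (simp add: le_imp_power_dvd)
  then have "q dvd v" by simp
  then obtain d where d: "v = q * d" by (meson dvdE)
  have "q^2 * d^2 = q^2 * q" using vq unfolding d by algebra
  then have dq: "d^2 = q" using nz by simp
  have v: "v = d^3" unfolding d dq[symmetric] by algebra
  have "v^2 * u^2 = v^2 * f" using eq vq by (simp add: mult.commute)
  then have "u^2 = f" using nz by simp
  then have "u^2 = p^3 - X_pol^2 * p * d^4 + X_pol^2 * d^6"
    unfolding f_def dq[symmetric] by algebra
  moreover have "coprime p d" using co(1) unfolding dq[symmetric] by simp
  moreover have "d \<noteq> 0" using nz dq by auto
  ultimately have "primitive_point p d u" by (simp add: primitive_point_def)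
  moreover have "x = to_fract p / to_fract d ^ 2" "y = to_fract u / to_fract d ^ 3"
    using x y by (simp_all add: v dq[symmetric] to_fract_power)
  ultimately show ?thesis by blast
qed

lemma primitive_point_coprime_r:
  assumes "primitive_point p d r"
  shows "coprime r d"
proof (rule coprimeI)
  fix c assume c: "c dvd r" "c dvd d"
  have "p^3 = r * r + d * (X_pol^2 * p * d^3 - X_pol^2 * d^5)"
    using assms unfolding primitive_point_def by algebra
  then have "c dvd p^3" using c by simp
  moreover have "coprime (p^3) d" using assms by (simp add: primitive_point_def)
  ultimately show "c dvd 1" using c coprime_common_divisor by blast
qed

lemma primitive_point_not_both_0:
  assumes "primitive_point p d r" "poly d a = 0"
  shows "poly p a \<noteq> 0"
proof
  assume "poly p a = 0"
  obtain u v where "u * p + v * d = 1" using assms coprime_poly_bezout unfolding primitive_point_def by blast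
  then have "poly (u * p + v * d) a = 1" by simp
  then show False using assms \<open>poly p a = 0\<close> by simp
qed

text \<open>A value of the abscissa, multiplied by d^2, would give \<open>p\<close> the value 0 at
  \<open>a\<close>, against coprimality.\<close>

lemma not_regular_x:
  assumes "primitive_point p d r" "poly d a = 0"
  shows "\<not> has_value_at a (to_fract p / to_fract d ^ 2) c"
proof
  assume "has_value_at a (to_fract p / to_fract d ^ 2) c"
  then have "has_value_at a (to_fract p / to_fract d ^ 2 * to_fract d ^ 2) (c * (poly d a)^2)"
    by (intro has_value_at_mult has_value_at_power has_value_at_to_fract)
  moreover have "to_fract p / to_fract d ^ 2 * to_fract d ^ 2 = to_fract p"
    using assms by (simp add: primitive_point_def)
  ultimately have "has_value_at a (to_fract p) 0" using assms by simp
  then have "poly p a = 0" using has_value_at_to_fract has_value_at_unique by blast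
  with primitive_point_not_both_0[OF assms] show False by simp
qed

section \<open>Degrees under duplication\<close>

text \<open>$p/d^2$ is the abscissa of the double of $(p'/d'^2, r'/d'^3)$.\<close>

definition double_of :: "rat poly \<Rightarrow> rat poly \<Rightarrow> rat poly \<Rightarrow> rat poly \<Rightarrow> rat poly \<Rightarrow> bool" where
  "double_of p' d' r' p d \<longleftrightarrow> 4 * p * r'^2 * d'^2 = d^2 * ((3 * p'^2 - X_pol^2 * d'^4)^2 - 8 * p' * r'^2)"

lemma coeff_square_bound:
  fixes A :: "rat poly"
  assumes "degree A \<le> m"
  shows "coeff (A^2) (2 * m) = (coeff A m)^2"
proof (cases "degree A = m")
  case True
  then show ?thesis using coeff_mult_degree_sum[of A A] by (simp add: power2_eq_square mult_2)
next
  case False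
  then have "degree (A^2) < 2 * m" using assms degree_power_le[of A 2] by linarith
  then show ?thesis using False assms by (simp add: coeff_eq_0)
qed

text \<open>Squares of rational leading coefficients cannot cancel.\<close>

lemma degree_sum_squares:
  fixes A B :: "rat poly"
  assumes "B \<noteq> 0"
  shows "degree (A^2 + B^2) = 2 * max (degree A) (degree B)"
proof (rule antisym)
  let ?m = "max (degree A) (degree B)"
  show "degree (A^2 + B^2) \<le> 2 * ?m"
    using degree_power_le[of A 2] degree_power_le[of B 2] by (intro degree_add_le) linarith+
  have "coeff (A^2 + B^2) (2 * ?m) = (coeff A ?m)^2 + (coeff B ?m)^2"
    by (simp add: coeff_square_bound)
  moreover have "coeff A ?m \<noteq> 0 \<or> coeff B ?m \<noteq> 0"
  proof (cases "degree A \<le> degree B")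
    case True
    then show ?thesis using assms by (simp add: max_def)
  next
    case False
    then have "A \<noteq> 0" by auto
    then show ?thesis using False by (simp add: max_def)
  qed
  ultimately have "coeff (A^2 + B^2) (2 * ?m) \<noteq> 0" by (simp add: sum_power2_eq_zero_iff)
  then show "2 * ?m \<le> degree (A^2 + B^2)" by (rule le_degree)
qed

text \<open>
  Doubles lie on the identity component of the fibre at infinity, so their abscissa has a pole there.
\<close>

lemma double_degree_growth:
  assumes pp: "primitive_point p' d' r'" "primitive_point p d r" and r0: "r' \<noteq> 0"
    and db: "double_of p' d' r' p d"
  shows "degree p \<ge> 2 * degree d + 2"
proof -
  define m where "m = max (degree p') (2 * degree d' + 1)"
  define N where "N = (3 * p'^2 - X_pol^2 * d'^4)^2 - 8 * p' * r'^2"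
  have d0: "d \<noteq> 0" "d' \<noteq> 0" using pp by (auto simp: primitive_point_def)
  \<comment> \<open>The duplication numerator is (x^2+t^2)^2 - 8t^2x: the degree of the sum of
    squares is known exactly, and the other term has smaller degree.\<close>
  have N: "N = (p'^2 + (X_pol * d'^2)^2)^2 + (- (8 * X_pol^2 * p' * d'^6))"
    using pp(1) unfolding N_def primitive_point_def by algebra
  have "X_pol * d'^2 \<noteq> 0" using d0 by simp
  then have "degree (p'^2 + (X_pol * d'^2)^2) = 2 * max (degree p') (degree (X_pol * d'^2))"
    by (rule degree_sum_squares)
  also have "degree (X_pol * d'^2) = 2 * degree d' + 1" using d0 by (simp add: degree_mult_eq degree_power_eq)
  finally have dS: "degree (p'^2 + (X_pol * d'^2)^2) = 2 * m" by (simp add: m_def)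
  have m1: "m \<ge> 1" by (simp add: m_def)
  have S0: "p'^2 + (X_pol * d'^2)^2 \<noteq> 0" using dS m1 by auto
  have dS2: "degree ((p'^2 + (X_pol * d'^2)^2)^2) = 4 * m" using S0 dS by (simp add: degree_power_eq)
  have "degree (8 * X_pol^2 * p' * d'^6) \<le> 2 + degree p' + 6 * degree d'"
  proof -
    have "degree (8 * X_pol^2 :: rat poly) \<le> 2"
      using degree_mult_le[of "8 :: rat poly" "X_pol^2"] by simp
    then show ?thesis
      using degree_mult_le[of "8 * X_pol^2 * p'" "d'^6"] degree_mult_le[of "8 * X_pol^2" p'] degree_power_le[of d' 6]
      by linarith
  qed
  also have "\<dots> < 4 * m"
  proof -
    have "degree p' \<le> m" "2 * degree d' + 1 \<le> m" by (auto simp: m_def)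
    then show ?thesis by linarith
  qed
  finally have "degree (- (8 * X_pol^2 * p' * d'^6)) < degree ((p'^2 + (X_pol * d'^2)^2)^2)"
    unfolding dS2 degree_minus .
  then have dN: "degree N = 4 * m" unfolding N dS2[symmetric] by (rule degree_add_eq_left)
  have N0: "N \<noteq> 0" using dN m1 by auto
  have eq: "4 * p * r'^2 * d'^2 = d^2 * N" using db by (simp add: double_of_def N_def)
  have p0: "p \<noteq> 0" using eq N0 d0 by auto
  have "degree (4 * p * r'^2 * d'^2) = degree p + 2 * degree r' + 2 * degree d'"
    using p0 r0 d0 by (simp add: degree_mult_eq degree_power_eq)
  moreover have "degree (d^2 * N) = 2 * degree d + 4 * m"
    using d0 N0 dN by (simp add: degree_mult_eq degree_power_eq)
  ultimately have e: "degree p + 2 * degree r' + 2 * degree d' = 2 * degree d + 4 * m" using eq by simp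
  have "2 * degree r' \<le> 3 * m"
    using pp(1) by (rule primitive_point_degree_r) (auto simp: m_def)
  then show ?thesis
  proof (cases "m = 2 * degree d' + 1")
    \<comment> \<open>Here \<open>m\<close> is odd, so \<open>2 * degree r'\<close> cannot equal
      \<open>3 * m\<close>; the bound relies on the 1 gained in this way.\<close>
    case True
    with \<open>2 * degree r' \<le> 3 * m\<close> have "2 * degree r' + 1 \<le> 3 * m" by presburger
    with e True show ?thesis by linarith
  next
    case False
    then have "m \<ge> 2 * degree d' + 2" by (simp add: m_def max_def split: if_splits)
    with e \<open>2 * degree r' \<le> 3 * m\<close> show ?thesis by linarith
  qed
qed

text \<open>
  If the denominator did not grow, $r'$ would divide $t^2(4t^2-27)$, a factor of the discriminant,
  which is too small for its degree.
\<close>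

lemma double_degree_less:
  assumes pp: "primitive_point p' d' r'" "primitive_point p d r" and r0: "r' \<noteq> 0"
    and db: "double_of p' d' r' p d" and dp: "degree p' \<ge> 2 * degree d' + 2" and d1: "degree d' \<ge> 1"
  shows "degree d' < degree d"
proof -
  define N where "N = (3 * p'^2 - X_pol^2 * d'^4)^2 - 8 * p' * r'^2"
  have eq: "4 * p * r'^2 * d'^2 = d^2 * N" using db by (simp add: double_of_def N_def)
  have d0: "d \<noteq> 0" "d' \<noteq> 0" using pp by (auto simp: primitive_point_def)
  have cN: "coprime d' N"
  proof (rule coprimeI)
    fix c assume c: "c dvd d'" "c dvd N"
    \<comment> \<open>Modulo \<open>d'\<close> the square \<open>r'^2\<close> is
      \<open>p'^3\<close>, so \<open>N\<close> becomes \<open>9 * p'^4 - 8 * p'^4\<close>.\<close>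
    have "p'^4 = N + d' * (8 * X_pol^2 * p' * d'^5 - 2 * X_pol^2 * p'^2 * d'^3 - X_pol^4 * d'^7)"
      using pp(1) unfolding primitive_point_def N_def by algebra
    then have "c dvd p'^4" using c by simp
    moreover have "coprime (p'^4) d'" using pp(1) by (simp add: primitive_point_def)
    ultimately show "c dvd 1" using c coprime_common_divisor by blast
  qed
  have "d'^2 dvd d^2 * N" unfolding eq[symmetric] by simp
  moreover have "coprime (d'^2) N" using cN by simp
  ultimately have "d'^2 dvd d^2" by (simp add: coprime_dvd_mult_left_iff)
  then have "d' dvd d" by simp
  then obtain c where c: "d = d' * c" by (meson dvdE)
  have c0: "c \<noteq> 0" using c d0 by auto
  show ?thesis
  proof (rule ccontr)
    assume "\<not> ?thesis"
    then have "degree c = 0" using c c0 d0 by (simp add: degree_mult_eq)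
    then obtain k where k: "c = [:k:]" by (rule degree_eq_zeroE)
    have k0: "k \<noteq> 0" using k c0 by auto
    have "d'^2 * (4 * p * r'^2) = d'^2 * (c^2 * N)" using eq unfolding c by algebra
    then have "4 * p * r'^2 = c^2 * N" using d0 by simp
    then have "r'^2 dvd c^2 * N" by (metis dvd_triv_right)
    moreover have "c^2 dvd 1" using k0 k by (simp add: is_unit_power_iff is_unit_const_poly_iff dvd_field_iff)
    ultimately have "r'^2 dvd N" by (metis dvd_mult_unit_iff' mult.commute)
    then have "r'^2 dvd N + 8 * p' * r'^2" by simp
    moreover have "N + 8 * p' * r'^2 = (3 * p'^2 - X_pol^2 * d'^4)^2" by (simp add: N_def)
    ultimately have rM: "r' dvd 3 * p'^2 - X_pol^2 * d'^4" by simp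
    have co: "coprime r' (d'^4)" using primitive_point_coprime_r[OF pp(1)] by simp
    \<comment> \<open>\<open>r'\<close> divides the numerators of f and of its derivative at the
      abscissa; the two combinations below eliminate \<open>p'\<close>.\<close>
    have "r' dvd r' * (3 * r') - p' * (3 * p'^2 - X_pol^2 * d'^4)" using rM by simp
    also have "r' * (3 * r') - p' * (3 * p'^2 - X_pol^2 * d'^4) = X_pol^2 * (3 * d'^2 - 2 * p') * d'^4"
      using pp(1) unfolding primitive_point_def by algebra
    finally have r1: "r' dvd X_pol^2 * (3 * d'^2 - 2 * p')" using co by (simp add: coprime_dvd_mult_left_iff)
    have "r' dvd (4 * X_pol^2) * (3 * p'^2 - X_pol^2 * d'^4) + (X_pol^2 * (3 * d'^2 - 2 * p')) * (3 * (2 * p' + 3 * d'^2))"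
      by (intro dvd_add dvd_mult[OF rM] dvd_mult2[OF r1])
    also have "(4 * X_pol^2) * (3 * p'^2 - X_pol^2 * d'^4) + (X_pol^2 * (3 * d'^2 - 2 * p')) * (3 * (2 * p' + 3 * d'^2))
      = X_pol^2 * (27 - 4 * X_pol^2) * d'^4" by algebra
    finally have r2: "r' dvd X_pol^2 * (27 - 4 * X_pol^2)" using co by (simp add: coprime_dvd_mult_left_iff)
    have e: "X_pol^2 * (27 - 4 * X_pol^2) = [:0, 0, 27, 0, -4:]"
      by (simp add: power2_eq_square numeral_poly)
    have "degree r' \<le> 4" using dvd_imp_degree_le[OF r2] unfolding e by simp
    moreover have "degree (r'^2) = 3 * degree p'"
    proof -
      have p0: "p' \<noteq> 0" using dp by auto
      have "degree (X_pol^2 * p' * d'^4) < 3 * degree p'"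
        using degree_mult_le[of "X_pol^2 * p'" "d'^4"] degree_mult_le[of "X_pol^2" p'] degree_power_le[of d' 4] dp
        unfolding degree_X_pol_sq by linarith
      moreover have "degree (X_pol^2 * d'^6) < 3 * degree p'"
        using degree_mult_le[of "X_pol^2" "d'^6"] degree_power_le[of d' 6] dp
        unfolding degree_X_pol_sq by linarith
      ultimately have "degree (X_pol^2 * d'^6 - X_pol^2 * p' * d'^4) < degree (p'^3)"
        using p0 by (simp add: degree_power_eq degree_diff_less)
      then have "degree (p'^3 + (X_pol^2 * d'^6 - X_pol^2 * p' * d'^4)) = degree (p'^3)"
        by (rule degree_add_eq_left)
      moreover have "r'^2 = p'^3 + (X_pol^2 * d'^6 - X_pol^2 * p' * d'^4)"
        using pp(1) unfolding primitive_point_def by simp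
      ultimately show ?thesis using p0 by (simp add: degree_power_eq)
    qed
    \<comment> \<open>\<open>3 * degree p'\<close> would equal \<open>2 * degree r'\<close>, which
      is at most 8, whereas \<open>degree p'\<close> is at least 4.\<close>
    ultimately show False using dp d1 r0 by (simp add: degree_power_eq)
  qed
qed
section \<open>The kernel of specialization\<close>

lemma rat_int_of_monic_quartic:
  fixes b :: rat and c2 c1 c0 :: int
  assumes "b^4 + of_int c2 * b^2 + of_int c1 * b + of_int c0 = 0"
  shows "\<exists>m::int. b = of_int m"
proof -
  obtain m n where mn: "quotient_of b = (m, n)" by force
  then have n: "n > 0" and co: "coprime m n" and b: "b = of_int m / of_int n"
    using quotient_of_denom_pos quotient_of_coprime quotient_of_div by auto
  have "of_int (m^4 + c2 * m^2 * n^2 + c1 * m * n^3 + c0 * n^4) = (0::rat)"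
    using assms n unfolding b by (simp add: field_simps power_numeral_reduce)
  then have "m^4 = n * (-(c2 * m^2 * n + c1 * m * n^2 + c0 * n^3))"
    by (simp only: of_int_eq_0_iff) (simp add: algebra_simps power_numeral_reduce)
  then have "n dvd m^4" by (metis dvd_triv_left)
  moreover have "coprime n (m^4)" using co by (simp add: coprime_commute)
  ultimately have "n dvd 1" by (meson coprime_common_divisor dvd_refl)
  with n b show ?thesis by auto
qed

text \<open>A root would be an integer \<open>m\<close> with (m-1)(t0^2 - m^2 - m - 1) = 1. Then
  \<open>m\<close> is 2 or 0, and t0^2 is 8 or 0.\<close>

lemma no_rational_two_torsion:
  fixes x t :: rat and t0 :: nat
  assumes "t0 > 2" "t = of_nat t0"
  shows "x^3 - t^2 * x + t^2 \<noteq> 0"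
proof
  assume h: "x^3 - t^2 * x + t^2 = 0"
  \<comment> \<open>The extra factor \<open>x\<close> brings the cubic into the shape of the monic
    quartic criterion for integral roots.\<close>
  then have "x * (x^3 - t^2 * x + t^2) = 0" by simp
  then have "x^4 + of_int (-(int t0^2)) * x^2 + of_int (int t0^2) * x + of_int 0 = 0"
    by (simp add: assms algebra_simps power_numeral_reduce)
  then obtain m where m: "x = of_int m" using rat_int_of_monic_quartic by blast
  have "of_int (m^3 - int t0^2 * m + int t0^2) = (0::rat)"
    using h by (simp add: m assms)
  then have e: "m^3 = int t0^2 * (m - 1)" by (simp only: of_int_eq_0_iff) (simp add: algebra_simps)
  have "m^3 = (m - 1) * (m^2 + m + 1) + 1" by (simp add: algebra_simps power_numeral_reduce)
  with e have "(m - 1) * (int t0^2 - (m^2 + m + 1)) = 1" by (simp add: algebra_simps)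
  then have "m - 1 = 1 \<or> m - 1 = -1" by (metis zmult_eq_1_iff)
  then have "m = 2 \<or> m = 0" by auto
  then show False
  proof
    assume "m = 2"
    with e have "int t0^2 = 8" by simp
    moreover have "int t0^2 \<ge> 3^2" using assms by (intro power_mono) auto
    ultimately show False by simp
  next
    assume "m = 0" with e assms show False by simp
  qed
qed

section \<open>Descent in the kernel\<close>

lemma poly_sq:
  "poly (sq0 X_pol u0 u1 u2) t = sq0 t (poly u0 t) (poly u1 t) (poly u2 t)"
  "poly (sq1 X_pol u0 u1 u2) t = sq1 t (poly u0 t) (poly u1 t) (poly u2 t)"
  "poly (sq2 X_pol u0 u1 u2) t = sq2 t (poly u0 t) (poly u1 t) (poly u2 t)"
  by (simp_all add: sq_defs)

text \<open>As d(t) = 0, the equation makes p(t) a nonzero square \<open>k^2\<close>. Evaluated at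
  \<open>t\<close>, each nontrivial alternative of \<open>descent\<close> is a case of
  \<open>doubled_x_of_square_class\<close>, which \<open>nh\<close> refutes.\<close>

lemma kernel_class:
  assumes pp: "primitive_point p d r" and d0: "poly d t = 0" and t: "t \<noteq> 0"
    and nh: "\<not> doubled_x t 0" "\<not> doubled_x t t" "\<not> doubled_x t (- t)"
  shows "\<exists>u0 u1 u2. sq0 X_pol u0 u1 u2 = p \<and> sq1 X_pol u0 u1 u2 = - X_pol * d^2 \<and> sq2 X_pol u0 u1 u2 = d^2"
proof -
  obtain u0 u1 u2 where u: "let q0 = sq0 X_pol u0 u1 u2; q1 = sq1 X_pol u0 u1 u2; q2 = sq2 X_pol u0 u1 u2; D = d^2; t = X_pol in
    (q0 = p \<and> q1 = - t * D \<and> q2 = D) \<or>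
    (q0 - t * q2 = p \<and> q1 + q0 = - t * D \<and> q2 + q1 + t * q2 = D) \<or>
    (q0 + t * q2 = p \<and> q1 - q0 = - t * D \<and> q2 - q1 - t * q2 = D) \<or>
    (q0 + t * (q1 + t * q2) = p \<and> q1 + t * q2 = - t * D \<and> q2 - q0 - t * (q1 + t * q2) = D)"
    using descent[OF pp] by blast
  define q0 q1 q2 where "q0 = sq0 t (poly u0 t) (poly u1 t) (poly u2 t)"
    and "q1 = sq1 t (poly u0 t) (poly u1 t) (poly u2 t)" and "q2 = sq2 t (poly u0 t) (poly u1 t) (poly u2 t)"
  note q = poly_sq[of u0 u1 u2 t, folded q0_def q1_def q2_def]
  have p0: "poly p t \<noteq> 0" using primitive_point_not_both_0[OF pp d0] .
  have "poly (r^2) t = poly (p^3 - X_pol^2 * p * d^4 + X_pol^2 * d^6) t"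
    using pp by (simp add: primitive_point_def)
  then have r: "(poly r t)^2 = (poly p t)^3" using d0 by simp
  define k where "k = poly r t / poly p t"
  have k0: "k \<noteq> 0" using r p0 by (auto simp: k_def)
  have k2: "k^2 = poly p t" unfolding k_def power_divide r using p0 by (simp add: power2_eq_square power3_eq_cube)
  note half = doubled_x_of_square_class[of k t "poly u0 t" "poly u1 t" "poly u2 t",
    folded q0_def q1_def q2_def, OF k0 t]
  have "\<not> (q0 - t * q2 = k^2 \<and> q1 + q0 = 0 \<and> q2 + q1 + t * q2 = 0)" using half[of t] nh by blast
  moreover have "\<not> (q0 + t * q2 = k^2 \<and> q1 - q0 = 0 \<and> q2 - q1 - t * q2 = 0)" using half[of "- t"] nh by blast
  moreover have "\<not> (q0 + t * (q1 + t * q2) = k^2 \<and> q1 + t * q2 = 0 \<and> q2 - q0 - t * (q1 + t * q2) = 0)"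
    using half[of 0] nh by blast
  \<comment> \<open>Passed on as a fact so that each case can evaluate its polynomial identities at
    \<open>t\<close>.\<close>
  moreover have "A = B \<Longrightarrow> poly A t = poly B t" for A B :: "rat poly" by simp
  ultimately show ?thesis
    using u unfolding Let_def
  proof (elim disjE conjE, goal_cases)
    case 1 then show ?case by blast
  next
    case 2
    from 2(4)[OF 2(5)] 2(4)[OF 2(6)] 2(4)[OF 2(7)] 2(1) show ?case by (simp add: q k2 d0)
  next
    case 3
    from 3(4)[OF 3(5)] 3(4)[OF 3(6)] 3(4)[OF 3(7)] 3(2) show ?case by (simp add: q k2 d0)
  next
    case 4
    from 4(4)[OF 4(5)] 4(4)[OF 4(6)] 4(4)[OF 4(7)] 4(3) show ?case by (simp add: q k2 d0)
  qed
qed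

text \<open>Dividing the coordinates by \<open>d\<close> gives a square root of x - theta over the
  function field. The resulting line is tangent at the half, and its slope \<open>b\<close> turns
  \<open>b^2 = x + 2 * X\<close> into the duplication formula.\<close>

lemma halving:
  assumes pp: "primitive_point p d r"
    and u: "sq0 X_pol u0 u1 u2 = p" "sq1 X_pol u0 u1 u2 = - X_pol * d^2" "sq2 X_pol u0 u1 u2 = d^2"
  shows "\<exists>X Y. Y^2 = X^3 - tvar^2 * X + tvar^2 \<and>
    (to_fract p / to_fract d ^ 2) * (2 * Y)^2 = (3 * X^2 - tvar^2)^2 - 8 * X * Y^2"
proof -
  define D where "D = to_fract d"
  have D: "D \<noteq> 0" using pp by (simp add: D_def primitive_point_def)
  define v0 v1 v2 x where "v0 = to_fract u0" and "v1 = to_fract u1" and "v2 = to_fract u2" and "x = to_fract p / D^2"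
  have t: "tvar \<noteq> 0" by (simp add: tvar_conv)
  have "sq0 tvar v0 v1 v2 = to_fract (sq0 X_pol u0 u1 u2)" "sq1 tvar v0 v1 v2 = to_fract (sq1 X_pol u0 u1 u2)"
    "sq2 tvar v0 v1 v2 = to_fract (sq2 X_pol u0 u1 u2)"
    unfolding sq_defs v0_def v1_def v2_def tvar_conv to_fract_mult to_fract_add to_fract_diff to_fract_power to_fract_numeral
    by (rule refl)+
  then have s: "sq0 tvar v0 v1 v2 = x * D^2" "sq1 tvar v0 v1 v2 = - tvar * D^2" "sq2 tvar v0 v1 v2 = D^2"
    using D unfolding u x_def D_def tvar_conv to_fract_mult to_fract_uminus to_fract_power by simp_all
  have "doubled_x tvar x"
  proof (rule doubled_x_of_square[OF t])
    show "sq0 tvar (v0/D) (v1/D) (v2/D) = x"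
      using s(1) D by (simp add: sq_defs field_simps power2_eq_square)
    show "sq1 tvar (v0/D) (v1/D) (v2/D) = - tvar"
      using s(2) D by (simp add: sq_defs field_simps power2_eq_square)
    show "sq2 tvar (v0/D) (v1/D) (v2/D) = 1"
      using s(3) D by (simp add: sq_defs field_simps power2_eq_square)
  qed
  then obtain X a b where h: "b^2 = x + 2 * X" "2 * a * b + X^2 + 2 * x * X = -(tvar^2)" "a^2 - x * X^2 = tvar^2"
    unfolding doubled_x_def by blast
  have Y: "(a + b * X)^2 = X^3 - tvar^2 * X + tvar^2" using h by algebra
  have l: "2 * b * (a + b * X) = 3 * X^2 - tvar^2" using h by algebra
  have "x * (2 * (a + b * X))^2 = (3 * X^2 - tvar^2)^2 - 8 * X * (a + b * X)^2"
    unfolding l[symmetric] using h(1) by algebra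
  with Y show ?thesis unfolding x_def D_def by blast
qed

text \<open>A half regular at \<open>t\<close> would have nonzero ordinate there, because the fibre
  has no rational 2-torsion. The duplication formula would then give a finite value to p/d^2, which
  has a pole at \<open>t\<close>.\<close>

lemma halving_in_kernel:
  fixes t0 :: nat and t :: rat
  assumes pp: "primitive_point p d r" and d0: "poly d t = 0" and t: "t = of_nat t0" "t0 > 2"
    and nh: "\<not> doubled_x t 0" "\<not> doubled_x t t" "\<not> doubled_x t (- t)"
  shows "\<exists>p' d' r'. primitive_point p' d' r' \<and> poly d' t = 0 \<and> r' \<noteq> 0 \<and> double_of p' d' r' p d"
proof -
  have tn: "t \<noteq> 0" using t by simp
  obtain u0 u1 u2 where u: "sq0 X_pol u0 u1 u2 = p" "sq1 X_pol u0 u1 u2 = - X_pol * d^2" "sq2 X_pol u0 u1 u2 = d^2"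
    using kernel_class[OF pp d0 tn nh] by blast
  obtain X Y where XY: "Y^2 = X^3 - tvar^2 * X + tvar^2"
    "(to_fract p / to_fract d ^ 2) * (2 * Y)^2 = (3 * X^2 - tvar^2)^2 - 8 * X * Y^2"
    using halving[OF pp u] by blast
  obtain p' d' r' where pp': "primitive_point p' d' r'" and X: "X = to_fract p' / to_fract d' ^ 2"
    and Y: "Y = to_fract r' / to_fract d' ^ 3"
    using primitive_representation[OF XY(1)] by blast
  have d'0: "poly d' t = 0"
  proof (rule ccontr)
    assume n: "poly d' t \<noteq> 0"
    define x y where "x = poly p' t / (poly d' t)^2" and "y = poly r' t / (poly d' t)^3"
    have hX: "has_value_at t X x" unfolding X x_def
      using n by (intro has_value_at_divide has_value_at_power has_value_at_to_fract) simp
    have hY: "has_value_at t Y y" unfolding Y y_def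
      using n by (intro has_value_at_divide has_value_at_power has_value_at_to_fract) simp
    have "has_value_at t (Y^2) (y^2)" by (intro has_value_at_intros hX hY)
    moreover have "has_value_at t (Y^2) (x^3 - t^2 * x + t^2)" unfolding XY(1) by (intro has_value_at_intros hX hY)
    ultimately have "y^2 = x^3 - t^2 * x + t^2" by (rule has_value_at_unique)
    then have y0: "y \<noteq> 0" using no_rational_two_torsion[OF t(2) t(1), of x] by auto
    then have "Y \<noteq> 0" using hY has_value_at_to_fract[of t 0] has_value_at_unique by fastforce
    then have "to_fract p / to_fract d ^ 2 = ((3 * X^2 - tvar^2)^2 - 8 * X * Y^2) / (2 * Y)^2"
      unfolding XY(2)[symmetric] by simp
    moreover have "has_value_at t (((3 * X^2 - tvar^2)^2 - 8 * X * Y^2) / (2 * Y)^2) (((3 * x^2 - t^2)^2 - 8 * x * y^2) / (2 * y)^2)"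
      using y0 by (intro has_value_at_divide has_value_at_intros hX hY) simp
    ultimately show False using not_regular_x[OF pp d0] by metis
  qed
  have r'0: "r' \<noteq> 0"
  proof
    assume "r' = 0"
    then have "coprime 0 d'" using primitive_point_coprime_r[OF pp'] by simp
    then have "d' dvd 1" by simp
    then have "poly d' t \<noteq> 0" by (metis dvdE mult_zero_left poly_1 poly_mult zero_neq_one)
    then show False using d'0 by simp
  qed
  define P D P' D' R' T where "P = to_fract p" and "D = to_fract d" and "P' = to_fract p'" and "D' = to_fract d'"
    and "R' = to_fract r'" and "T = to_fract X_pol"
  have nz: "D \<noteq> 0" "D' \<noteq> 0" using pp pp' by (simp_all add: D_def D'_def primitive_point_def)
  have e: "(P / D^2) * (2 * (R' / D'^3))^2 = (3 * (P' / D'^2)^2 - T^2)^2 - 8 * (P' / D'^2) * (R' / D'^3)^2"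
    using XY(2) unfolding X Y tvar_conv P_def D_def P'_def D'_def R'_def T_def .
  have "4 * P * R'^2 * D'^2 = D^2 * D'^8 * ((P / D^2) * (2 * (R' / D'^3))^2)"
    using nz by (simp add: field_simps power_numeral_reduce)
  also have "\<dots> = D^2 * ((3 * P'^2 - T^2 * D'^4)^2 - 8 * P' * R'^2)"
  proof -
    have "D'^8 * (3 * (P' / D'^2)^2 - T^2)^2 = (D'^4 * (3 * (P' / D'^2)^2 - T^2))^2" by (simp add: power_mult_distrib)
    also have "D'^4 * (3 * (P' / D'^2)^2 - T^2) = 3 * P'^2 - T^2 * D'^4"
      using nz by (simp add: field_simps power_numeral_reduce)
    finally have 1: "D'^8 * (3 * (P' / D'^2)^2 - T^2)^2 = (3 * P'^2 - T^2 * D'^4)^2" .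
    have 2: "D'^8 * (8 * (P' / D'^2) * (R' / D'^3)^2) = 8 * P' * R'^2"
      using nz by (simp add: field_simps power_numeral_reduce)
    show ?thesis unfolding e mult.assoc right_diff_distrib 1[unfolded mult.assoc] 2[unfolded mult.assoc] ..
  qed
  finally have "to_fract (4 * p * r'^2 * d'^2) = to_fract (d^2 * ((3 * p'^2 - X_pol^2 * d'^4)^2 - 8 * p' * r'^2))"
    by (simp only: to_fract_mult to_fract_diff to_fract_power to_fract_numeral P_def D_def P'_def D'_def R'_def T_def)
  then have "double_of p' d' r' p d" unfolding double_of_def to_fract_eq_iff .
  with pp' d'0 r'0 show ?thesis by blast
qed

text \<open>The point is halved twice: the second halving exhibits p'/d'^2 as a double, which gives
  the degree gap that \<open>double_degree_less\<close> asks for.\<close>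

lemma kernel_trivial:
  fixes t0 :: nat and t :: rat
  assumes t: "t = of_nat t0" "t0 > 2"
    and nh: "\<not> doubled_x t 0" "\<not> doubled_x t t" "\<not> doubled_x t (- t)"
  shows "primitive_point p d r \<Longrightarrow> poly d t \<noteq> 0"
proof (induction "degree d" arbitrary: p d r rule: less_induct)
  case less
  show ?case
  proof
    assume d0: "poly d t = 0"
    obtain p' d' r' where 1: "primitive_point p' d' r'" "poly d' t = 0" "r' \<noteq> 0" "double_of p' d' r' p d"
      using halving_in_kernel[OF less.prems d0 t nh] by blast
    obtain p'' d'' r'' where 2: "primitive_point p'' d'' r''" "r'' \<noteq> 0" "double_of p'' d'' r'' p' d'"
      using halving_in_kernel[OF 1(1,2) t nh] by blast
    have "degree p' \<ge> 2 * degree d' + 2" by (rule double_degree_growth[OF 2(1) 1(1) 2(2,3)])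
    moreover have "degree d' \<ge> 1"
    proof (rule ccontr)
      assume "\<not> ?thesis"
      then have "degree d' = 0" by simp
      then obtain c where "d' = [:c:]" by (rule degree_eq_zeroE)
      then show False using 1 by (auto simp: primitive_point_def)
    qed
    ultimately have "degree d' < degree d" by (rule double_degree_less[OF 1(1) less.prems 1(3,4)])
    then show False using less.hyps 1 by blast
  qed
qed

text \<open>The chord through one point and the negative of the other has a third point on the
  curve. If the two specialisations agree but the abscissas differ, its slope has denominator of
  value 0 and numerator of value 2b, nonzero, so this third point would specialise to
  infinity.\<close>

lemma specialize_inj:
  fixes t0 :: nat and t :: rat
  assumes t: "t = of_nat t0" "t0 > 2"
    and nh: "\<not> doubled_x t 0" "\<not> doubled_x t t" "\<not> doubled_x t (- t)"
  shows "inj_on (specialize t) E_points"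
proof -
  have reg: "\<exists>a b. has_value_at t x a \<and> has_value_at t y b \<and> b \<noteq> 0"
    if xy: "y^2 = x^3 - tvar^2 * x + tvar^2" for x y
  proof -
    obtain p d r where pp: "primitive_point p d r" and x: "x = to_fract p / to_fract d ^ 2"
      and y: "y = to_fract r / to_fract d ^ 3"
      using primitive_representation[OF xy] by blast
    have n: "poly d t \<noteq> 0" using kernel_trivial[OF t nh pp] .
    define a b where "a = poly p t / (poly d t)^2" and "b = poly r t / (poly d t)^3"
    have hX: "has_value_at t x a" unfolding x a_def
      using n by (intro has_value_at_divide has_value_at_power has_value_at_to_fract) simp
    have hY: "has_value_at t y b" unfolding y b_def
      using n by (intro has_value_at_divide has_value_at_power has_value_at_to_fract) simp
    have "has_value_at t (y^2) (b^2)" by (intro has_value_at_intros hX hY)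
    moreover have "has_value_at t (y^2) (a^3 - t^2 * a + t^2)" unfolding xy by (intro has_value_at_intros hX hY)
    ultimately have "b^2 = a^3 - t^2 * a + t^2" by (rule has_value_at_unique)
    then have "b \<noteq> 0" using no_rational_two_torsion[OF t(2) t(1), of a] by auto
    with hX hY show ?thesis by blast
  qed
  have val: "\<exists>a b. has_value_at t x a \<and> has_value_at t y b \<and> b \<noteq> 0 \<and> specialize t (Some (x, y)) = Some (a, b)"
    if "y^2 = x^3 - tvar^2 * x + tvar^2" for x y
    using reg[OF that] by (auto simp: regular_at_iff eval_at_eq)
  have main: "x1 = x2 \<and> y1 = y2"
    if e1: "y1^2 = x1^3 - tvar^2 * x1 + tvar^2" and e2: "y2^2 = x2^3 - tvar^2 * x2 + tvar^2"
      and s: "specialize t (Some (x1, y1)) = specialize t (Some (x2, y2))" for x1 y1 x2 y2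
  proof -
    obtain a b where 1: "has_value_at t x1 a" "has_value_at t y1 b" "b \<noteq> 0"
      and s1: "specialize t (Some (x1, y1)) = Some (a, b)" using val[OF e1] by blast
    obtain a' b' where 2: "has_value_at t x2 a'" "has_value_at t y2 b'"
      and s2: "specialize t (Some (x2, y2)) = Some (a', b')" using val[OF e2] by blast
    have ab: "a' = a" "b' = b" using s s1 s2 by auto
    have xx: "x1 = x2"
    proof (rule ccontr)
      assume ne: "x1 \<noteq> x2"
      define l where "l = (y1 + y2) / (x1 - x2)"
      define x3 where "x3 = l^2 - x1 - x2"
      define y3 where "y3 = y1 + l * (x3 - x1)"
      have l: "l * (x1 - x2) = y1 + y2" using ne by (simp add: l_def)
      have "(x1 - x2) * (y3^2) = (x1 - x2) * (x3^3 - tvar^2 * x3 + tvar^2)"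
        using e1 e2 l unfolding y3_def x3_def by algebra
      then have e3: "y3^2 = x3^3 - tvar^2 * x3 + tvar^2" using ne by simp
      obtain c where c: "has_value_at t x3 c" using reg[OF e3] by blast
      \<comment> \<open>Multiplying \<open>l^2\<close> by \<open>(x1 - x2)^2\<close> avoids dividing
        by a function of value 0.\<close>
      have "has_value_at t ((x3 + x1 + x2) * (x1 - x2)^2) ((c + a + a) * (a - a)^2)"
        by (intro has_value_at_intros c 1 2[unfolded ab])
      moreover have "(x3 + x1 + x2) * (x1 - x2)^2 = (y1 + y2)^2"
        unfolding x3_def l[symmetric] by algebra
      moreover have "has_value_at t ((y1 + y2)^2) ((b + b)^2)"
        by (intro has_value_at_intros 1 2[unfolded ab])
      ultimately have "(b + b)^2 = 0" using has_value_at_unique by fastforce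
      then show False using 1(3) by simp
    qed
    have "y1^2 = y2^2" using e1 e2 xx by simp
    then have "y1 = y2 \<or> y1 = - y2" by (simp add: power2_eq_iff)
    moreover have "y1 \<noteq> - y2"
    proof
      assume "y1 = - y2"
      then have "has_value_at t y1 (- b)" using has_value_at_uminus[OF 2(2)] ab by simp
      then have "- b = b" using 1(2) has_value_at_unique by blast
      then show False using 1(3) by simp
    qed
    ultimately show ?thesis using xx by blast
  qed
  have none: "specialize t (Some (x, y)) \<noteq> None" if "y^2 = x^3 - tvar^2 * x + tvar^2" for x y
    using val[OF that] by (metis option.distinct(1))
  show ?thesis
  proof (rule inj_onI)
    fix P Q assume P: "P \<in> E_points" and Q: "Q \<in> E_points" and eq: "specialize t P = specialize t Q"
    consider "P = None" | x y where "P = Some (x, y)" "y^2 = x^3 - tvar^2 * x + tvar^2"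
      using P by (auto simp: E_points_def)
    then show "P = Q"
    proof cases
      case 1
      then have sQ: "specialize t Q = None" using eq by simp
      have "Q = None"
      proof (rule ccontr)
        assume "Q \<noteq> None"
        then obtain x y where "Q = Some (x, y)" "y^2 = x^3 - tvar^2 * x + tvar^2"
          using Q by (auto simp: E_points_def)
        then show False using none sQ by metis
      qed
      with 1 show ?thesis by simp
    next
      case 2
      note P2 = 2
      consider "Q = None" | x' y' where "Q = Some (x', y')" "y'^2 = x'^3 - tvar^2 * x' + tvar^2"
        using Q by (auto simp: E_points_def)
      then show ?thesis
      proof cases
        case 1
        then show ?thesis using eq none P2 by (metis specialize.simps(1))
      next
        case 2
        then show ?thesis using main[of y x y' x'] P2 eq by (auto simp del: specialize.simps)
      qed
    qed
  qed
qed

section \<open>The Pell equation and the exceptional forms\<close>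

text \<open>\<open>pellH\<close> and \<open>pellP\<close> are the half-companion Pell numbers 1, 1,
  3, 7, ... and the Pell numbers 0, 1, 2, 5, ..., continued to negative indices.\<close>

definition pellH :: "int \<Rightarrow> real" where
  "pellH k = ((1 + sqrt 2) powi k + (1 - sqrt 2) powi k) / 2"

definition pellP :: "int \<Rightarrow> real" where
  "pellP k = ((1 + sqrt 2) powi k - (1 - sqrt 2) powi k) / (2 * sqrt 2)"

definition Pform :: "int \<Rightarrow> real" where
  "Pform k = 4 * pellP k ^ 3 * (2 * pellH k + 3 * pellP k)"

definition Hform :: "int \<Rightarrow> real" where
  "Hform k = pellH k ^ 3 * (4 * pellP k + 3 * pellH k)"

lemma pell_powi:
  "(1 + sqrt 2) powi k = pellH k + pellP k * sqrt 2"
  "(1 - sqrt 2) powi k = pellH k - pellP k * sqrt 2"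
  by (simp_all add: pellH_def pellP_def field_simps)

lemma form_conv:
  "form1 n = Pform (2 * n)" "form2 n = Pform (2 * n + 1)"
  "form3 n = Hform (2 * n + 1)" "form4 n = Hform (2 * n)"
proof -
  have 1: "((1 + sqrt 2) powi k + (1 - sqrt 2) powi k) / 2 = pellH k"
    "((1 + sqrt 2) powi k - (1 - sqrt 2) powi k) / (4 * sqrt 2) = pellP k / 2"
    "(1 + sqrt 2) powi k + (1 - sqrt 2) powi k = 2 * pellH k"
    "((1 + sqrt 2) powi k - (1 - sqrt 2) powi k) / (2 * sqrt 2) = pellP k"
    "sqrt 2 * ((1 + sqrt 2) powi k - (1 - sqrt 2) powi k) = 4 * pellP k" for k
    unfolding pell_powi by (simp_all add: field_simps)
  show "form1 n = Pform (2 * n)" unfolding form1_def Let_def 1 Pform_def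
    by (simp add: field_simps power_numeral_reduce)
  show "form2 n = Pform (2 * n + 1)" unfolding form2_def Let_def 1 Pform_def
    by (simp add: field_simps power_numeral_reduce)
  show "form3 n = Hform (2 * n + 1)" unfolding form3_def Let_def 1 Hform_def
    by (simp add: field_simps power_numeral_reduce)
  show "form4 n = Hform (2 * n)" unfolding form4_def Let_def 1 Hform_def
    by (simp add: field_simps power_numeral_reduce)
qed

lemma T_set_iff: "t0 \<in> T_set \<longleftrightarrow> t0 > 2 \<and> (\<forall>k. real t0 \<noteq> Pform k \<and> real t0 \<noteq> Hform k)"
proof -
  have "(\<exists>n. x = form1 n \<or> x = form2 n \<or> x = form3 n \<or> x = form4 n) \<longleftrightarrow> (\<exists>k. x = Pform k \<or> x = Hform k)" for x
    unfolding form_conv by (metis evenE oddE)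
  then show ?thesis by (simp add: T_set_def)
qed

lemma pell_step: "pellH (k + 1) = pellH k + 2 * pellP k" "pellP (k + 1) = pellH k + pellP k"
proof -
  have "1 + sqrt 2 \<noteq> (0::real)" "1 - sqrt 2 \<noteq> (0::real)"
    by (smt (verit) real_sqrt_ge_0_iff, simp)
  then have 1: "(1 + sqrt 2) powi (k + 1) = (1 + sqrt 2) powi k * (1 + sqrt 2)"
    "(1 - sqrt 2) powi (k + 1) = (1 - sqrt 2) powi k * (1 - sqrt 2)"
    by (simp_all add: power_int_add)
  show "pellH (k + 1) = pellH k + 2 * pellP k"
    unfolding pellH_def[of "k + 1"] 1 unfolding pell_powi by (simp add: field_simps)
  show "pellP (k + 1) = pellH k + pellP k"
    unfolding pellP_def[of "k + 1"] 1 unfolding pell_powi by (simp add: field_simps)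
qed

lemma pell_back: "pellH (k - 1) = 2 * pellP k - pellH k" "pellP (k - 1) = pellH k - pellP k"
  using pell_step[of "k - 1"] by simp_all

lemma pell_0 [simp]: "pellH 0 = 1" "pellP 0 = 0"
  by (simp_all add: pellH_def pellP_def)

lemma pell_neg_nat:
  "pellH (- int k) = (-1)^k * pellH (int k) \<and> pellP (- int k) = - ((-1)^k * pellP (int k))"
proof (induction k)
  case (Suc k)
  have "- int (Suc k) = - int k - 1" "int (Suc k) = int k + 1" by simp_all
  then show ?case using Suc by (simp only: pell_back pell_step) (simp add: algebra_simps)
qed simp

lemma pell_neg: "\<exists>s. (s = 1 \<or> s = -1) \<and> pellH (- k) = s * pellH k \<and> pellP (- k) = - (s * pellP k)"
proof (cases "k \<ge> 0")
  case True
  then show ?thesis using pell_neg_nat[of "nat k"]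
    by (intro exI[of _ "(-1)^nat k"]) (simp add: minus_one_power_iff)
next
  case False
  define s :: real where "s = (-1)^nat (- k)"
  have s: "s = 1 \<or> s = -1" by (simp add: s_def minus_one_power_iff)
  then have "s * s = 1" by auto
  moreover have "pellH k = s * pellH (- k)" "pellP k = - (s * pellP (- k))"
    using pell_neg_nat[of "nat (- k)"] False by (simp_all add: s_def)
  ultimately have "pellH (- k) = s * pellH k" "pellP (- k) = - (s * pellP k)"
    by (simp_all add: mult.assoc[symmetric])
  with s show ?thesis by blast
qed

lemma Pform_neg: "Pform (- k) = 4 * pellP k ^ 3 * (3 * pellP k - 2 * pellH k)"
  using pell_neg[of k] by (elim exE conjE disjE) (simp_all add: Pform_def algebra_simps power_numeral_reduce)

lemma Hform_neg: "Hform (- k) = pellH k ^ 3 * (3 * pellH k - 4 * pellP k)"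
  using pell_neg[of k] by (elim exE conjE disjE) (simp_all add: Hform_def algebra_simps power_numeral_reduce)

lemma pell_norm: "pellH k ^ 2 - 2 * pellP k ^ 2 = (if even k then 1 else -1)"
proof -
  have "pellH k ^ 2 - 2 * pellP k ^ 2 = (pellH k + pellP k * sqrt 2) * (pellH k - pellP k * sqrt 2)"
    by (simp add: algebra_simps power2_eq_square)
  also have "\<dots> = ((1 + sqrt 2) * (1 - sqrt 2)) powi k"
    unfolding pell_powi[symmetric] by (simp add: power_int_mult_distrib)
  also have "(1 + sqrt 2) * (1 - sqrt 2) = (-1::real)" by (simp add: algebra_simps)
  finally show ?thesis by (simp add: power_int_minus_one_minus power_int_minus_left)
qed

lemma pell_double:
  "pellH (2 * k) = pellH k ^ 2 + 2 * pellP k ^ 2" "pellP (2 * k) = 2 * pellH k * pellP k"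
proof -
  have 1: "x powi (2 * k) = (x powi k)^2" for x :: real
    by (metis mult.commute power_int_mult power_int_of_nat of_nat_numeral)
  show "pellH (2 * k) = pellH k ^ 2 + 2 * pellP k ^ 2"
    unfolding pellH_def[of "2 * k"] 1 unfolding pell_powi by (simp add: field_simps power2_eq_square)
  show "pellP (2 * k) = 2 * pellH k * pellP k"
    unfolding pellP_def[of "2 * k"] 1 unfolding pell_powi by (simp add: field_simps power2_eq_square)
qed

text \<open>Dividing c + m sqrt 2 by 1 + sqrt 2 gives (2m-c) + (c-m) sqrt 2, of opposite norm; for m
  > 0 the bounds m <= c < 2m make the new pair admissible and smaller.\<close>

lemma pell_solution_nonneg:
  fixes c m :: int
  assumes "c > 0" "m \<ge> 0" "c^2 - 2 * m^2 = 1 \<or> c^2 - 2 * m^2 = -1"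
  shows "\<exists>k. of_int c = pellH k \<and> of_int m = pellP k"
  using assms
proof (induction "nat m" arbitrary: c m rule: less_induct)
  case less
  show ?case
  proof (cases "m = 0")
    case True
    then have "c^2 = 1" using less.prems by (auto, smt (verit) zero_le_power2)
    then have "c = 1" using less.prems by (simp add: power2_eq_1_iff)
    then show ?thesis using True by (intro exI[of _ 0]) simp
  next
    case False
    then have m1: "m \<ge> 1" using less.prems by simp
    then have mm: "m^2 \<ge> 1" by (simp add: one_le_power)
    have "c \<ge> m"
    proof (rule ccontr)
      assume "\<not> c \<ge> m"
      then have "c \<le> m - 1" by simp
      then have "c^2 \<le> (m-1)^2" using less.prems(1) by (intro power_mono) auto
      then have "c^2 \<le> m^2 - 2 * m + 1" by (simp add: power2_diff)
      then show False using less.prems(3) mm m1 by auto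
    qed
    have "c < 2 * m"
    proof (rule ccontr)
      assume "\<not> c < 2 * m"
      then have "c^2 \<ge> (2*m)^2" using m1 by (intro power_mono) auto
      then show False using less.prems(3) mm by (auto simp: power_mult_distrib)
    qed
    have "nat (c - m) < nat m" using \<open>c < 2 * m\<close> m1 by simp
    moreover have "(2 * m - c)^2 - 2 * (c - m)^2 = -(c^2 - 2 * m^2)" by algebra
    then have "(2 * m - c)^2 - 2 * (c - m)^2 = 1 \<or> (2 * m - c)^2 - 2 * (c - m)^2 = -1"
      using less.prems(3) by auto
    ultimately obtain k where k: "of_int (2 * m - c) = pellH k" "of_int (c - m) = pellP k"
      using less.hyps[of "c - m" "2 * m - c"] \<open>c < 2 * m\<close> \<open>c \<ge> m\<close> by auto
    have "of_int c = pellH (k + 1)" "of_int m = pellP (k + 1)"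
      unfolding pell_step k[symmetric] by simp_all
    then show ?thesis by blast
  qed
qed

lemma pell_solution_pos:
  fixes c m :: int
  assumes "c > 0" "c^2 - 2 * m^2 = 1 \<or> c^2 - 2 * m^2 = -1"
  shows "\<exists>k e. (e = 1 \<or> e = -1) \<and> of_int c = e * pellH k \<and> of_int m = e * pellP k"
proof (cases "m \<ge> 0")
  case True
  then show ?thesis using pell_solution_nonneg[OF assms(1) True assms(2)] by (metis mult_1)
next
  case False
  then obtain k where k: "of_int c = pellH k" "of_int (- m) = pellP k"
    using pell_solution_nonneg[of c "- m"] assms by auto
  obtain s where s: "s = 1 \<or> s = -1" "pellH (- k) = s * pellH k" "pellP (- k) = - (s * pellP k)"
    using pell_neg by blast
  have "of_int c = s * pellH (- k)" "of_int m = s * pellP (- k)" using s k by auto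
  with s show ?thesis by blast
qed

lemma pell_solution:
  fixes c m :: int
  assumes "c^2 - 2 * m^2 = 1 \<or> c^2 - 2 * m^2 = -1"
  shows "\<exists>k e. (e = 1 \<or> e = -1) \<and> of_int c = e * pellH k \<and> of_int m = e * pellP k"
proof -
  have "c \<noteq> 0"
  proof
    assume "c = 0"
    then have "2 * m^2 = 1 \<or> 2 * m^2 = -1 \<or> 2 * m^2 = 1" using assms by auto
    then show False by presburger
  qed
  then consider "c > 0" | "- c > 0" by linarith
  then show ?thesis
  proof cases
    case 1
    then show ?thesis using pell_solution_pos assms by blast
  next
    case 2
    then obtain k e where "e = 1 \<or> e = -1" "of_int (- c) = e * pellH k" "of_int (- m) = e * pellP k"
      using pell_solution_pos[of "- c" "- m"] assms by auto
    then show ?thesis by (intro exI[of _ k] exI[of _ "- e"]) auto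
  qed
qed

section \<open>Points of the fibre that are doubles\<close>

text \<open>The slope satisfies m^2(4 - m^2) = 4(t0 + m)^2 up to sign, so |m| is at most 2, and
  \<open>m\<close> is negative. The value -2 gives t0 = 2, and -1 fails by parity.\<close>

lemma zero_not_doubled_x:
  fixes t0 :: nat
  assumes "t0 > 2"
  shows "\<not> doubled_x (of_nat t0 :: rat) 0"
proof
  assume "doubled_x (of_nat t0 :: rat) 0"
  then obtain X a b where h: "b^2 = 0 + 2 * X" "2 * a * b + X^2 + 2 * 0 * X = -((of_nat t0 :: rat)^2)"
    "a^2 - 0 * X^2 = (of_nat t0)^2" unfolding doubled_x_def by blast
  have "a = of_nat t0 \<or> a = - of_nat t0" using h(3) by (simp add: power2_eq_iff)
  \<comment> \<open>The sign of \<open>a\<close> is absorbed into \<open>b'\<close>.\<close>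
  then obtain b' where b': "a * b = of_nat t0 * b'" "b'^2 = b^2"
  proof
    assume "a = of_nat t0" then show thesis using that[of b] by simp
  next
    assume "a = - of_nat t0" then show thesis using that[of "- b"] by simp
  qed
  have q: "b'^4 + of_int 0 * b'^2 + of_int (8 * int t0) * b' + of_int (4 * int t0^2) = 0"
  proof -
    have "b'^4 + 8 * of_nat t0 * b' + 4 * (of_nat t0)^2 = 0" using h b' by algebra
    then show ?thesis by simp
  qed
  then obtain m where m: "b' = of_int m" using rat_int_of_monic_quartic by blast
  have "of_int (m^4 + 8 * int t0 * m + 4 * int t0^2) = (0::rat)" using q by (simp add: m)
  then have e: "m^4 + 8 * int t0 * m + 4 * int t0^2 = 0" by (simp only: of_int_eq_0_iff)
  have "m^2 * (4 - m^2) = 4 * (int t0 + m)^2" using e by algebra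
  then have "m^2 * (4 - m^2) \<ge> 0" by simp
  moreover have "m \<noteq> 0" using e assms by auto
  ultimately have "m^2 \<le> 4" by (simp add: zero_le_mult_iff)
  then have "\<bar>m\<bar> \<le> 2" using abs_le_square_iff[of m 2] by simp
  then have "m = -2 \<or> m = -1 \<or> m = 0 \<or> m = 1 \<or> m = 2" by auto
  moreover have "m < 0"
  proof (rule ccontr)
    assume "\<not> m < 0"
    then have "m^4 + 8 * int t0 * m \<ge> 0" by simp
    moreover have "int t0^2 > 0" using assms by simp
    ultimately show False using e by linarith
  qed
  ultimately have "m = -2 \<or> m = -1" by auto
  then show False
  proof
    assume "m = -2"
    then have "4 * (int t0 - 2)^2 = 0" using e by algebra
    then show False using assms by simp
  next
    assume "m = -1"
    then have "1 - 8 * int t0 + 4 * int t0^2 = 0" using e by simp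
    then show False by presburger
  qed
qed

text \<open>\<open>T\<close> may have either sign: \<open>doubled_x\<close> involves
  \<open>t\<close> only through \<open>t^2\<close>, so \<open>T = - int t0\<close> covers the
  abscissa -t0.\<close>

lemma doubled_x_self_quartic:
  fixes T :: int
  assumes "doubled_x (of_int T :: rat) (of_int T)"
  shows "\<exists>m. m^4 - 6 * T * m^2 + 8 * T * m + T^2 = 0"
proof -
  define t :: rat where "t = of_int T"
  obtain X a b where h: "b^2 = t + 2 * X" "2 * a * b + X^2 + 2 * t * X = -(t^2)" "a^2 - t * X^2 = t^2"
    using assms unfolding doubled_x_def t_def by blast
  \<comment> \<open>The tangent line meets the curve again at abscissa \<open>t\<close>, where f(t)
    = t^2.\<close>
  have abt: "(a + b * t)^2 = t^2" using h by algebra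
  have "8 * a * b + (2 * X)^2 + 4 * t * (2 * X) = -(4 * t^2)" using h(2) by algebra
  moreover have "2 * X = b^2 - t" using h(1) by simp
  ultimately have X2: "8 * a * b + (b^2 - t)^2 + 4 * t * (b^2 - t) = -(4 * t^2)" by simp
  have "a + b * t = t \<or> a + b * t = - t" using abt by (simp add: power2_eq_iff)
  then obtain b' where q: "b'^4 - 6 * t * b'^2 + 8 * t * b' + t^2 = 0"
  proof
    assume "a + b * t = t"
    then have a: "a = t - b * t" by simp
    have "b^4 - 6 * t * b^2 + 8 * t * b + t^2 = 0" using X2 unfolding a by algebra
    then show thesis using that by blast
  next
    assume "a + b * t = - t"
    then have a: "a = - t - b * t" by simp
    have "(- b)^4 - 6 * t * (- b)^2 + 8 * t * (- b) + t^2 = 0" using X2 unfolding a by algebra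
    then show thesis using that by blast
  qed
  have "b'^4 + of_int (- 6 * T) * b'^2 + of_int (8 * T) * b' + of_int (T^2) = 0"
    using q by (simp add: t_def)
  then obtain m where m: "b' = of_int m" using rat_int_of_monic_quartic by blast
  have "of_int (m^4 - 6 * T * m^2 + 8 * T * m + T^2) = (0::rat)" using q by (simp add: m t_def)
  then show ?thesis by (intro exI[of _ m]) (simp only: of_int_eq_0_iff)
qed

text \<open>All terms of the quartic are nonnegative unless \<open>m = 1\<close>, and then it is
  (t0-1)^2.\<close>

lemma minus_t_not_doubled_x:
  fixes t0 :: nat
  assumes "t0 > 2"
  shows "\<not> doubled_x (of_nat t0 :: rat) (- of_nat t0)"
proof
  assume "doubled_x (of_nat t0 :: rat) (- of_nat t0)"
  then have "doubled_x (of_int (- int t0) :: rat) (of_int (- int t0))"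
    by (simp add: doubled_x_def)
  then obtain m where "m^4 - 6 * (- int t0) * m^2 + 8 * (- int t0) * m + (- int t0)^2 = 0"
    using doubled_x_self_quartic by blast
  then have e: "m^4 + int t0 * (m * (6 * m - 8)) + int t0^2 = 0" by (simp add: algebra_simps power2_eq_square)
  have "m = 1"
  proof (rule ccontr)
    assume "m \<noteq> 1"
    then have "m \<le> 0 \<or> m \<ge> 2" by linarith
    then have "m * (6 * m - 8) \<ge> 0" by (auto simp: zero_le_mult_iff)
    then have "int t0 * (m * (6 * m - 8)) \<ge> 0" by simp
    moreover have "int t0^2 > 0" using assms by simp
    moreover have "m^4 \<ge> 0" by simp
    ultimately show False using e by linarith
  qed
  then have "(int t0 - 1)^2 = 0" using e by algebra
  then show False using assms by simp
qed

text \<open>Completing the square in \<open>T\<close> makes 2(m-1)(m-2) a square n^2, that is,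
  (2m-3)^2 - 2n^2 = 1. The Pell solutions then parametrise t0 = m(3m - 4 + 2n).\<close>

lemma doubled_x_t_imp_form:
  fixes t0 :: nat
  assumes t: "t0 > 2" and half: "doubled_x (of_nat t0 :: rat) (of_nat t0)"
  shows "\<exists>k. real t0 = Pform k \<or> real t0 = Hform k"
proof -
  define T where "T = int t0"
  have "doubled_x (of_int T :: rat) (of_int T)" using half by (simp add: T_def)
  then obtain m where e: "m^4 - 6 * T * m^2 + 8 * T * m + T^2 = 0" using doubled_x_self_quartic by blast
  have m0: "m \<noteq> 0" using e t by (auto simp: T_def)
  have sq: "(2 * m)^2 * (2 * (m - 1) * (m - 2)) = (T + 4 * m - 3 * m^2)^2" using e by algebra
  then have "(2 * m)^2 dvd (T + 4 * m - 3 * m^2)^2" by (metis dvd_triv_left)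
  then have "2 * m dvd T + 4 * m - 3 * m^2" by (simp only: pow_divides_pow_iff)
  then obtain n where n: "T + 4 * m - 3 * m^2 = 2 * m * n" by (meson dvdE)
  have "(2 * m)^2 * (2 * (m - 1) * (m - 2)) = (2 * m)^2 * n^2" unfolding sq n by algebra
  moreover have "(2 * m)^2 \<noteq> 0" using m0 by simp
  ultimately have n2: "2 * (m - 1) * (m - 2) = n^2" by (metis mult_left_cancel)
  have "(2 * m - 3)^2 - 2 * n^2 = 1" unfolding n2[symmetric] by algebra
  then obtain j e where je: "e = 1 \<or> e = -1" "of_int (2 * m - 3) = e * pellH j" "of_int n = e * pellP j"
    and nrm: "(2 * m - 3)^2 - 2 * n^2 = 1"
    using pell_solution by blast
  have "real_of_int ((2 * m - 3)^2 - 2 * n^2) = e^2 * (pellH j ^ 2 - 2 * pellP j ^ 2)"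
    using je(2,3) by (simp add: power_mult_distrib algebra_simps)
  then have "pellH j ^ 2 - 2 * pellP j ^ 2 = 1" using je(1) nrm by auto
  \<comment> \<open>Norm 1 forces an even index, so 2m-3 and n become quadratic in the Pell numbers
    of half the index.\<close>
  then have "even j" using pell_norm[of j] by (auto split: if_splits)
  then obtain i where i: "j = 2 * i" by (elim evenE)
  define h p M N where "h = pellH i" and "p = pellP i" and "M = real_of_int m" and "N = real_of_int n"
  have M: "2 * M - 3 = e * (h^2 + 2 * p^2)" and N: "N = e * (2 * h * p)"
    using je(2,3) unfolding i pell_double by (simp_all add: h_def p_def M_def N_def)
  have "real_of_int (T + 4 * m - 3 * m^2) = real_of_int (2 * m * n)" using n by simp
  then have tt: "real t0 = M * (3 * M - 4 + 2 * N)"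
    by (simp add: T_def M_def N_def algebra_simps power2_eq_square)
  \<comment> \<open>h + p and h + 2p are the Pell numbers of index i + 1. The linear cofactors need
    the conjugate sign, hence the negated index.\<close>
  have fe: "Pform (- (i + 1)) = 4 * (h + p)^3 * (h - p)"
    unfolding Pform_neg pell_step h_def p_def by (simp add: algebra_simps)
  have fo: "Hform (- (i + 1)) = (h + 2 * p)^3 * (2 * p - h)"
    unfolding Hform_neg pell_step h_def p_def by (simp add: algebra_simps)
  have "h^2 - 2 * p^2 = 1 \<or> h^2 - 2 * p^2 = -1" using pell_norm[of i] by (auto simp: h_def p_def)
  then consider "e = 1" "h^2 - 2 * p^2 = 1" | "e = 1" "h^2 - 2 * p^2 = -1"
    | "e = -1" "h^2 - 2 * p^2 = 1" | "e = -1" "h^2 - 2 * p^2 = -1" using je(1) by blast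
  then show ?thesis
  proof cases
    case 1
    then have "M = 2 * (h^2 - p^2)" "N = 2 * h * p" using M N by auto
    moreover have "3 * M - 4 + 2 * N = 2 * (h + p)^2" using M N 1 by algebra
    ultimately have "real t0 = Pform (- (i + 1))" unfolding fe tt by algebra
    then show ?thesis by blast
  next
    case 2
    then have "M = 4 * p^2 - h^2" "N = 2 * h * p" using M N by auto
    moreover have "3 * M - 4 + 2 * N = (h + 2 * p)^2" using M N 2 by algebra
    ultimately have "real t0 = Hform (- (i + 1))" unfolding fo tt by algebra
    then show ?thesis by blast
  next
    case 3
    then have "M = h^2 - 4 * p^2" "N = - 2 * h * p" using M N by auto
    moreover have "3 * M - 4 + 2 * N = -((h + 2 * p)^2)" using M N 3 by algebra
    ultimately have "real t0 = Hform (- (i + 1))" unfolding fo tt by algebra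
    then show ?thesis by blast
  next
    case 4
    then have "M = 2 * (p^2 - h^2)" "N = - 2 * h * p" using M N by auto
    moreover have "3 * M - 4 + 2 * N = -(2 * (h + p)^2)" using M N 4 by algebra
    ultimately have "real t0 = Pform (- (i + 1))" unfolding fe tt by algebra
    then show ?thesis by blast
  qed
qed

section \<open>Density of the exceptional set\<close>

lemma pell_nat_bounds:
  "pellH (int k) \<in> \<int> \<and> pellP (int k) \<in> \<int> \<and> pellH (int k) \<ge> 1 \<and> pellH (int k) \<ge> real k \<and> pellP (int k) \<ge> real k"
proof (induction k)
  case (Suc k)
  have "int (Suc k) = int k + 1" by simp
  then show ?case using Suc by (simp only: pell_step) auto
qed simp

lemma pell_bounds:
  "pellH k \<in> \<int>" "pellP k \<in> \<int>" "\<bar>pellH k\<bar> \<ge> \<bar>real_of_int k\<bar>" "\<bar>pellP k\<bar> \<ge> \<bar>real_of_int k\<bar>"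
proof -
  have "pellH k \<in> \<int> \<and> pellP k \<in> \<int> \<and> \<bar>pellH k\<bar> \<ge> \<bar>real_of_int k\<bar> \<and> \<bar>pellP k\<bar> \<ge> \<bar>real_of_int k\<bar>"
  proof (cases "k \<ge> 0")
    case True
    then show ?thesis using pell_nat_bounds[of "nat k"] by auto
  next
    case False
    then have "pellH (- k) \<in> \<int> \<and> pellP (- k) \<in> \<int> \<and> pellH (- k) \<ge> real_of_int (- k) \<and> pellP (- k) \<ge> real_of_int (- k)"
      using pell_nat_bounds[of "nat (- k)"] by auto
    moreover obtain s where "s = 1 \<or> s = -1" "pellH (- (- k)) = s * pellH (- k)" "pellP (- (- k)) = - (s * pellP (- k))"
      using pell_neg by blast
    ultimately show ?thesis using False by (elim disjE) auto
  qed
  then show "pellH k \<in> \<int>" "pellP k \<in> \<int>" "\<bar>pellH k\<bar> \<ge> \<bar>real_of_int k\<bar>" "\<bar>pellP k\<bar> \<ge> \<bar>real_of_int k\<bar>" by auto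
qed

text \<open>A nonzero integer cofactor has absolute value at least 1. Linear growth of
  \<open>x\<close> in the index suffices, since a bound by k^2 already leaves only O(sqrt n)
  indices.\<close>

lemma Ints_mult_cube_bound:
  fixes x y :: real and k :: int
  assumes "x \<in> \<int>" "y \<in> \<int>" "x^3 * y \<noteq> 0" "\<bar>real_of_int k\<bar> \<le> \<bar>x\<bar>"
  shows "real_of_int (k^2) \<le> \<bar>x^3 * y\<bar>"
proof -
  have "x \<noteq> 0" "y \<noteq> 0" using assms by auto
  then have "\<bar>x\<bar> \<ge> 1" "\<bar>y\<bar> \<ge> 1" using assms by (simp_all add: Ints_nonzero_abs_ge1)
  have "real_of_int (k^2) = \<bar>real_of_int k\<bar>^2" by simp
  also have "\<dots> \<le> \<bar>x\<bar>^2" using assms(4) by (intro power_mono) auto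
  also have "\<dots> \<le> \<bar>x\<bar>^3" using \<open>\<bar>x\<bar> \<ge> 1\<close> by (intro power_increasing) auto
  also have "\<dots> \<le> \<bar>x\<bar>^3 * \<bar>y\<bar>" using \<open>\<bar>y\<bar> \<ge> 1\<close> mult_left_mono[of 1 "\<bar>y\<bar>" "\<bar>x\<bar>^3"] by simp
  finally show ?thesis by (simp add: abs_mult power_abs)
qed

lemma form_index_bound:
  assumes "real t = Pform k \<or> real t = Hform k" "t > 0"
  shows "real_of_int (k^2) \<le> real t"
  using assms(1)
proof
  assume e: "real t = Pform k"
  then have "pellP k ^ 3 * (4 * (2 * pellH k + 3 * pellP k)) \<noteq> 0" "\<bar>pellP k ^ 3 * (4 * (2 * pellH k + 3 * pellP k))\<bar> = real t"
    using assms(2) by (auto simp: Pform_def algebra_simps)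
  then show ?thesis using Ints_mult_cube_bound[of "pellP k" "4 * (2 * pellH k + 3 * pellP k)" k] pell_bounds[of k]
    by auto
next
  assume e: "real t = Hform k"
  then have "pellH k ^ 3 * (4 * pellP k + 3 * pellH k) \<noteq> 0" "\<bar>pellH k ^ 3 * (4 * pellP k + 3 * pellH k)\<bar> = real t"
    using assms(2) by (auto simp: Hform_def)
  then show ?thesis using Ints_mult_cube_bound[of "pellH k" "4 * pellP k + 3 * pellH k" k] pell_bounds[of k]
    by auto
qed

text \<open>Besides 1 and 2, only values of the two forms at indices in \<open>{-M..M}\<close> are
  lost, at most 2 + 2(2M+1) numbers in all.\<close>

lemma card_T_set_lower:
  "real (card {k \<in> T_set. k \<le> n}) \<ge> real n - 4 - 4 * sqrt (real n)"
proof -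
  define M where "M = \<lfloor>sqrt (real n)\<rfloor>"
  \<comment> \<open>The floors only move the forms into the naturals; they are exact where a form
    equals a natural number.\<close>
  define Ex where "Ex = (\<lambda>k. nat \<lfloor>Pform k\<rfloor>) ` {-M..M} \<union> (\<lambda>k. nat \<lfloor>Hform k\<rfloor>) ` {-M..M}"
  have M0: "M \<ge> 0" by (simp add: M_def)
  have cI: "card {-M..M} = nat (2 * M + 1)" by simp
  have cE: "card Ex \<le> 2 * nat (2 * M + 1)"
    unfolding Ex_def
    using card_Un_le[of "(\<lambda>k. nat \<lfloor>Pform k\<rfloor>) ` {-M..M}" "(\<lambda>k. nat \<lfloor>Hform k\<rfloor>) ` {-M..M}"]
      card_image_le[of "{-M..M}" "\<lambda>k. nat \<lfloor>Pform k\<rfloor>"] card_image_le[of "{-M..M}" "\<lambda>k. nat \<lfloor>Hform k\<rfloor>"] cI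
    by simp
  have sub: "{1..n} \<subseteq> {k \<in> T_set. k \<le> n} \<union> ({1, 2} \<union> Ex)"
  proof
    fix t assume t: "t \<in> {1..n}"
    show "t \<in> {k \<in> T_set. k \<le> n} \<union> ({1, 2} \<union> Ex)"
    proof (cases "t \<in> T_set \<or> t \<le> 2")
      case True
      then show ?thesis using t by auto
    next
      case False
      then obtain k where k: "real t = Pform k \<or> real t = Hform k" by (auto simp: T_set_iff)
      have "real_of_int (k^2) \<le> real n" using form_index_bound[OF k] t by fastforce
      then have "\<bar>real_of_int k\<bar> \<le> sqrt (real n)" by (simp add: real_le_rsqrt)
      then have "\<bar>k\<bar> \<le> M" unfolding M_def by (simp add: le_floor_iff)
      then have "k \<in> {-M..M}" by auto
      moreover have "t = nat \<lfloor>Pform k\<rfloor> \<or> t = nat \<lfloor>Hform k\<rfloor>" using k by (metis floor_of_nat nat_int)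
      ultimately have "t \<in> Ex" unfolding Ex_def by blast
      then show ?thesis by blast
    qed
  qed
  have "finite Ex" by (simp add: Ex_def)
  then have "card {1..n} \<le> card ({k \<in> T_set. k \<le> n} \<union> ({1, 2} \<union> Ex))"
    using sub by (intro card_mono) auto
  also have "\<dots> \<le> card {k \<in> T_set. k \<le> n} + (card {1, 2::nat} + card Ex)"
    using card_Un_le[of "{k \<in> T_set. k \<le> n}" "{1, 2} \<union> Ex"] card_Un_le[of "{1, 2}" Ex] by linarith
  finally have "n \<le> card {k \<in> T_set. k \<le> n} + 2 + 2 * nat (2 * M + 1)" using cE by simp
  then have "real n \<le> real (card {k \<in> T_set. k \<le> n} + 2 + 2 * nat (2 * M + 1))" by (simp only: of_nat_le_iff)
  also have "\<dots> = real (card {k \<in> T_set. k \<le> n}) + 4 + 4 * real_of_int M" using M0 by simp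
  also have "\<dots> \<le> real (card {k \<in> T_set. k \<le> n}) + 4 + 4 * sqrt (real n)" by (simp add: M_def)
  finally show ?thesis by simp
qed

lemma card_T_set_upper: "card {k \<in> T_set. k \<le> n} \<le> n"
proof -
  have "{k \<in> T_set. k \<le> n} \<subseteq> {1..n}" by (auto simp: T_set_def)
  then show ?thesis using card_mono[of "{1..n}" "{k \<in> T_set. k \<le> n}"] by simp
qed

lemma density_T_set: "natural_density T_set 1"
  unfolding natural_density_def
proof (rule tendsto_sandwich)
  show "\<forall>\<^sub>F n in sequentially. (real n - 4 - 4 * sqrt (real n)) / real n \<le> real (card {k \<in> T_set. k \<le> n}) / real n"
    by (intro always_eventually allI divide_right_mono card_T_set_lower) simp
  show "\<forall>\<^sub>F n in sequentially. real (card {k \<in> T_set. k \<le> n}) / real n \<le> 1"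
  proof (intro always_eventually allI)
    fix n
    show "real (card {k \<in> T_set. k \<le> n}) / real n \<le> 1"
      \<comment> \<open>At \<open>n = 0\<close> the quotient is 0, the default for division by
        zero.\<close>
      by (cases "n = 0") (simp_all add: divide_le_eq_1 card_T_set_upper)
  qed
  show "(\<lambda>n. (real n - 4 - 4 * sqrt (real n)) / real n) \<longlonglongrightarrow> 1" by real_asymp
  show "(\<lambda>n. 1::real) \<longlonglongrightarrow> 1" by simp
qed

theorem theorem4p8:
  shows "natural_density T_set 1 \<and>
         (\<forall>t0 \<in> T_set. inj_on (specialize (of_nat t0)) E_points)"
proof (intro conjI ballI density_T_set)
  fix t0 assume t0: "t0 \<in> T_set"
  then have t: "t0 > 2" by (simp add: T_set_def)
  have "\<not> doubled_x (of_nat t0 :: rat) (of_nat t0)" using doubled_x_t_imp_form[OF t] t0 by (auto simp: T_set_iff)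
  then show "inj_on (specialize (of_nat t0)) E_points"
    using specialize_inj[OF refl t zero_not_doubled_x[OF t] _ minus_t_not_doubled_x[OF t]] by blast
qed

end
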